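(* Let $q$ be a prime with $q\equiv 3\pmod 4$ and $q\neq 3$. For groups $X,Y$ of order $4q$ let $N(X,Y)$ be the number of isomorphism classes of skew braces $(B,+,\circ)$ with $(B,+)\cong X$ and $(B,\circ)\cong Y$. For each of $X=\mathbb{Z}_q\rtimes_{-1}\mathbb{Z}_4$ and $X=\mathbb{Z}_2\times(\mathbb{Z}_q\rtimes_{-1}\mathbb{Z}_2)$ one has $$N(X,\mathbb{Z}_{4q})=2,\quad N(X,\mathbb{Z}_q\rtimes_{-1}\mathbb{Z}_4)=2,\quad N(X,\mathbb{Z}_2^2\times\mathbb{Z}_q)=2,\quad N(X,\mathbb{Z}_2\times(\mathbb{Z}_q\rtimes_{-1}\mathbb{Z}_2))=4.$$
   Context: A skew (left) brace is a triple $(B,+,\circ)$ where $(B,+)$ and $(B,\circ)$ are groups (not necessarily abelian) such that $a\circ(b+c)=a\circ b-a+a\circ c$ for all $a,b,c\in B$; isomorphisms are bijections preserving both operations. Groups: $\mathbb{Z}_q\rtimes_{-1}\mathbb{Z}_4=\langle\sigma,\tau\mid\sigma^4=\tau^q=1,\ \sigma\tau\sigma^{-1}=\tau^{-1}\rangle$ and $\mathbb{Z}_2\times(\mathbb{Z}_q\rtimes_{-1}\mathbb{Z}_2)=\langle\sigma,\tau,\epsilon\mid\sigma^2=\tau^2=\epsilon^q=1,\ [\epsilon,\tau]=[\tau,\sigma]=1,\ \sigma\epsilon\sigma^{-1}=\epsilon^{-1}\rangle$. *)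

theory Defs
  imports "HOL-Algebra.Ring" "HOL-Algebra.Elementary_Groups" "HOL-Number_Theory.Cong"
begin

section \<open>Skew braces\<close>

text \<open>
  The record of \<^theory>\<open>HOL-Algebra.Ring\<close> is reused as a signature with two group structures on
  one carrier: \<^term>\<open>add_monoid B\<close> is $(B,+)$, and the multiplicative structure of
  \<open>B\<close> itself is $(B,\circ)$. Neither group is assumed to be abelian.
\<close>

locale skew_brace = group B for B :: "'a ring" (structure) +
  assumes add_group: "group (add_monoid B)"
    and brace_law: "\<lbrakk>a \<in> carrier B; b \<in> carrier B; c \<in> carrier B\<rbrakk> \<Longrightarrow>
      a \<otimes> (b \<oplus> c) = ((a \<otimes> b) \<oplus> (\<ominus> a)) \<oplus> (a \<otimes> c)"

definition brace_iso :: "'a ring \<Rightarrow> 'b ring \<Rightarrow> ('a \<Rightarrow> 'b) set" where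
  "brace_iso B C = iso (add_monoid B) (add_monoid C) \<inter> iso B C"

definition brace_isomorphic :: "'a ring \<Rightarrow> 'b ring \<Rightarrow> bool" where
  "brace_isomorphic B C \<longleftrightarrow> brace_iso B C \<noteq> {}"

text \<open>
  To count isomorphism classes, all carriers are taken inside the type \<^typ>\<open>nat\<close>. This is no loss
  for finite skew braces, by \<open>skew_brace_copy_on_nat\<close> below. The relation ignores the values of the
  operations outside the carrier, so these do not affect the number of classes.
\<close>

definition skew_braces_of_type :: "'b monoid \<Rightarrow> 'c monoid \<Rightarrow> nat ring set" where
  "skew_braces_of_type G H = {B. skew_brace B \<and> add_monoid B \<cong> G \<and> B \<cong> H}"

definition iso_rel_of_type :: "'b monoid \<Rightarrow> 'c monoid \<Rightarrow> (nat ring \<times> nat ring) set" where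
  "iso_rel_of_type G H = {(B, C). B \<in> skew_braces_of_type G H \<and>
     C \<in> skew_braces_of_type G H \<and> brace_isomorphic B C}"

definition num_skew_braces :: "'b monoid \<Rightarrow> 'c monoid \<Rightarrow> nat" where
  "num_skew_braces G H = card (skew_braces_of_type G H // iso_rel_of_type G H)"

lemma equiv_iso_rel_of_type:
  "equiv (skew_braces_of_type G H) (iso_rel_of_type G H)"
proof (rule equivI)
  show "iso_rel_of_type G H \<subseteq> skew_braces_of_type G H \<times> skew_braces_of_type G H"
    by (auto simp: iso_rel_of_type_def)
  show "refl_on (skew_braces_of_type G H) (iso_rel_of_type G H)"
  proof (rule refl_onI)
    fix B assume "B \<in> skew_braces_of_type G H"
    moreover have "(\<lambda>x. x) \<in> brace_iso B B"
      unfolding brace_iso_def by (intro IntI iso_set_refl)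
    ultimately show "(B, B) \<in> iso_rel_of_type G H"
      by (auto simp: iso_rel_of_type_def brace_isomorphic_def)
  qed
  show "sym (iso_rel_of_type G H)"
  proof (rule symI)
    fix B C assume BC: "(B, C) \<in> iso_rel_of_type G H"
    then obtain h where h: "h \<in> iso (add_monoid B) (add_monoid C)" "h \<in> iso B C"
      by (auto simp: iso_rel_of_type_def brace_isomorphic_def brace_iso_def)
    have B: "skew_brace B"
      using BC by (auto simp: iso_rel_of_type_def skew_braces_of_type_def)
    have "inv_into (carrier B) h \<in> iso C B"
      using B h by (intro group.iso_set_sym) (auto simp: skew_brace_def)
    moreover have "inv_into (carrier B) h \<in> iso (add_monoid C) (add_monoid B)"
      using group.iso_set_sym[OF skew_brace.add_group[OF B] h(1)] by simp
    ultimately show "(C, B) \<in> iso_rel_of_type G H"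
      using BC by (auto simp: iso_rel_of_type_def brace_isomorphic_def brace_iso_def)
  qed
  show "trans (iso_rel_of_type G H)"
  proof (rule transI)
    fix B C D assume BC: "(B, C) \<in> iso_rel_of_type G H" and CD: "(C, D) \<in> iso_rel_of_type G H"
    obtain g h where "g \<in> brace_iso B C" "h \<in> brace_iso C D"
      using BC CD by (auto simp: iso_rel_of_type_def brace_isomorphic_def)
    then have "h \<circ> g \<in> brace_iso B D"
      unfolding brace_iso_def by (auto intro: iso_set_trans)
    then show "(B, D) \<in> iso_rel_of_type G H"
      using BC CD by (auto simp: iso_rel_of_type_def brace_isomorphic_def)
  qed
qed

lemma group_transport:
  assumes "group G" and bij: "bij_betw h (carrier G) (carrier H)"
    and mult: "\<And>x y. x \<in> carrier G \<Longrightarrow> y \<in> carrier G \<Longrightarrow> h (x \<otimes>\<^bsub>G\<^esub> y) = h x \<otimes>\<^bsub>H\<^esub> h y"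
    and one: "h \<one>\<^bsub>G\<^esub> = \<one>\<^bsub>H\<^esub>"
  shows "group H"
proof -
  interpret G: group G by fact
  have car: "carrier H = h ` carrier G"
    using bij by (simp add: bij_betw_def)
  show ?thesis
  proof (rule groupI)
    show "x \<otimes>\<^bsub>H\<^esub> y \<in> carrier H" if "x \<in> carrier H" "y \<in> carrier H" for x y
      using that unfolding car by (auto simp flip: mult)
    show "\<one>\<^bsub>H\<^esub> \<in> carrier H"
      unfolding car one[symmetric] by simp
    show "x \<otimes>\<^bsub>H\<^esub> y \<otimes>\<^bsub>H\<^esub> z = x \<otimes>\<^bsub>H\<^esub> (y \<otimes>\<^bsub>H\<^esub> z)"
      if "x \<in> carrier H" "y \<in> carrier H" "z \<in> carrier H" for x y z
      using that unfolding car by (auto simp flip: mult simp: G.m_assoc)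
    show "\<one>\<^bsub>H\<^esub> \<otimes>\<^bsub>H\<^esub> x = x" if "x \<in> carrier H" for x
      using that unfolding car one[symmetric] by (auto simp flip: mult)
    show "\<exists>y\<in>carrier H. y \<otimes>\<^bsub>H\<^esub> x = \<one>\<^bsub>H\<^esub>" if x: "x \<in> carrier H" for x
    proof -
      obtain a where a: "a \<in> carrier G" "x = h a"
        using x unfolding car by blast
      then have "h (inv\<^bsub>G\<^esub> a) \<otimes>\<^bsub>H\<^esub> x = \<one>\<^bsub>H\<^esub>"
        by (simp flip: mult one)
      then show ?thesis
        using a unfolding car by blast
    qed
  qed
qed

lemma skew_brace_copy_on_nat:
  fixes B :: "'a ring"
  assumes B: "skew_brace B" and fin: "finite (carrier B)"
  shows "\<exists>C :: nat ring. skew_brace C \<and> brace_isomorphic B C"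
proof -
  interpret skew_brace B by fact
  interpret A: group "add_monoid B" by (rule add_group)
  obtain h :: "'a \<Rightarrow> nat" where inj: "inj_on h (carrier B)"
    using finite_imp_inj_to_nat_seg[OF fin] by blast
  define g where "g = inv_into (carrier B) h"
  have gh: "g (h x) = x" if "x \<in> carrier B" for x
    using inj that by (simp add: g_def)
  define C :: "nat ring" where
    "C = \<lparr>carrier = h ` carrier B, monoid.mult = \<lambda>x y. h (g x \<otimes>\<^bsub>B\<^esub> g y), one = h \<one>\<^bsub>B\<^esub>,
          zero = h \<zero>\<^bsub>B\<^esub>, add = \<lambda>x y. h (g x \<oplus>\<^bsub>B\<^esub> g y)\<rparr>"
  have bij: "bij_betw h (carrier B) (carrier C)"
    using inj by (simp add: bij_betw_def C_def)
  have hm: "h (x \<otimes>\<^bsub>B\<^esub> y) = h x \<otimes>\<^bsub>C\<^esub> h y" if "x \<in> carrier B" "y \<in> carrier B" for x y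
    using that by (simp add: C_def gh)
  have ha: "h (x \<oplus>\<^bsub>B\<^esub> y) = h x \<oplus>\<^bsub>C\<^esub> h y" if "x \<in> carrier B" "y \<in> carrier B" for x y
    using that by (simp add: C_def gh)
  have C: "group C"
    by (rule group_transport[OF is_group bij]) (auto simp: hm, simp add: C_def)
  have addC: "group (add_monoid C)"
    using bij ha by (intro group_transport[OF add_group, where h = h]) (auto, simp add: C_def)
  interpret AC: group "add_monoid C" by (rule addC)
  have isoA: "h \<in> iso (add_monoid B) (add_monoid C)"
    using bij ha by (auto simp: iso_def hom_def bij_betw_def)
  have isoM: "h \<in> iso B C"
    using bij hm by (auto simp: iso_def hom_def bij_betw_def)
  interpret hh: group_hom "add_monoid B" "add_monoid C" h
    using isoA by unfold_locales (simp add: iso_def)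
  have hneg: "h (\<ominus>\<^bsub>B\<^esub> x) = \<ominus>\<^bsub>C\<^esub> h x" if "x \<in> carrier B" for x
    using hh.hom_inv[of x] that by (simp add: a_inv_def)
  have add_cl: "x \<oplus>\<^bsub>B\<^esub> y \<in> carrier B" if "x \<in> carrier B" "y \<in> carrier B" for x y
    using A.m_closed[of x y] that by simp
  have neg_cl: "\<ominus>\<^bsub>B\<^esub> x \<in> carrier B" if "x \<in> carrier B" for x
    using A.inv_closed[of x] that by (simp add: a_inv_def)
  have "skew_brace C"
  proof (intro skew_brace.intro skew_brace_axioms.intro C addC)
    fix a b c assume "a \<in> carrier C" "b \<in> carrier C" "c \<in> carrier C"
    then obtain x y z where xyz: "x \<in> carrier B" "y \<in> carrier B" "z \<in> carrier B"
      "a = h x" "b = h y" "c = h z"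
      by (auto simp: C_def)
    have "h (x \<otimes>\<^bsub>B\<^esub> (y \<oplus>\<^bsub>B\<^esub> z)) = h (((x \<otimes>\<^bsub>B\<^esub> y) \<oplus>\<^bsub>B\<^esub> (\<ominus>\<^bsub>B\<^esub> x)) \<oplus>\<^bsub>B\<^esub> (x \<otimes>\<^bsub>B\<^esub> z))"
      using xyz by (simp add: brace_law)
    then show "a \<otimes>\<^bsub>C\<^esub> (b \<oplus>\<^bsub>C\<^esub> c) = a \<otimes>\<^bsub>C\<^esub> b \<oplus>\<^bsub>C\<^esub> (\<ominus>\<^bsub>C\<^esub> a) \<oplus>\<^bsub>C\<^esub> (a \<otimes>\<^bsub>C\<^esub> c)"
      using xyz by (simp add: hm ha hneg add_cl neg_cl)
  qed
  then show ?thesis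
    using isoA isoM by (auto simp: brace_isomorphic_def brace_iso_def)
qed

section \<open>The groups\<close>

definition semidirect_prod ::
  "('a, 'm) monoid_scheme \<Rightarrow> ('b, 'n) monoid_scheme \<Rightarrow> ('b \<Rightarrow> 'a \<Rightarrow> 'a) \<Rightarrow> ('a \<times> 'b) monoid" where
  "semidirect_prod G H \<phi> =
    \<lparr>carrier = carrier G \<times> carrier H,
     monoid.mult = (\<lambda>(g, h) (g', h'). (g \<otimes>\<^bsub>G\<^esub> \<phi> h g', h \<otimes>\<^bsub>H\<^esub> h')),
     one = (\<one>\<^bsub>G\<^esub>, \<one>\<^bsub>H\<^esub>)\<rparr>"

text \<open>
  $\mathbb{Z}_q \rtimes_{-1} \mathbb{Z}_n$ for even \<open>n\<close>: the generator of $\mathbb{Z}_n$ acts by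
  inversion, hence odd residues act by inversion and even ones trivially.
\<close>

definition inversion_semidirect :: "nat \<Rightarrow> nat \<Rightarrow> (int \<times> int) monoid" where
  "inversion_semidirect q n = semidirect_prod (integer_mod_group q) (integer_mod_group n)
     (\<lambda>j a. if even j then a else inv\<^bsub>integer_mod_group q\<^esub> a)"

text \<open>The group satisfies the presentation
  $\langle \sigma, \tau \mid \sigma^n = \tau^q = 1,\ \sigma\tau\sigma^{-1} = \tau^{-1} \rangle$
  with $\sigma = (0,1)$ and $\tau = (1,0)$. As the relations bound the order by $qn$, which is its
  order, it is the group so presented.\<close>

lemma carrier_inversion_semidirect:
  "q > 0 \<Longrightarrow> n > 0 \<Longrightarrow> carrier (inversion_semidirect q n) = {0..<int q} \<times> {0..<int n}"
  by (simp add: inversion_semidirect_def semidirect_prod_def carrier_integer_mod_group)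

lemma one_inversion_semidirect: "\<one>\<^bsub>inversion_semidirect q n\<^esub> = (0, 0)"
  by (simp add: inversion_semidirect_def semidirect_prod_def)

lemma mult_inversion_semidirect:
  assumes "q > 0" "b \<in> {0..<int q}"
  shows "(a, i) \<otimes>\<^bsub>inversion_semidirect q n\<^esub> (b, j) =
    ((a + (if even i then b else - b)) mod int q, (i + j) mod int n)"
  using assms
  by (simp add: inversion_semidirect_def semidirect_prod_def carrier_integer_mod_group mod_simps)

lemma order_inversion_semidirect:
  "q > 0 \<Longrightarrow> n > 0 \<Longrightarrow> order (inversion_semidirect q n) = q * n"
  by (simp add: order_def carrier_inversion_semidirect)

lemma group_inversion_semidirect:
  assumes q: "q > 0" and n: "n > 0" "even n"
  shows "group (inversion_semidirect q n)" (is "group ?G")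
proof -
  have par: "even (i mod int n) \<longleftrightarrow> even i" for i
    using n by (simp add: dvd_mod_iff)
  note car = carrier_inversion_semidirect[OF q n(1)]
  note mul = mult_inversion_semidirect[OF q]
  show ?thesis
  proof (rule groupI)
    show "x \<otimes>\<^bsub>?G\<^esub> y \<in> carrier ?G" if "x \<in> carrier ?G" "y \<in> carrier ?G" for x y
      using that q n by (cases x; cases y) (auto simp: car mul)
    show "\<one>\<^bsub>?G\<^esub> \<in> carrier ?G"
      using q n by (simp add: car one_inversion_semidirect)
    show "x \<otimes>\<^bsub>?G\<^esub> y \<otimes>\<^bsub>?G\<^esub> z = x \<otimes>\<^bsub>?G\<^esub> (y \<otimes>\<^bsub>?G\<^esub> z)"
      if "x \<in> carrier ?G" "y \<in> carrier ?G" "z \<in> carrier ?G" for x y z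
      using that q
      by (cases x; cases y; cases z)
        (auto simp: car mul par mod_simps algebra_simps)
    show "\<one>\<^bsub>?G\<^esub> \<otimes>\<^bsub>?G\<^esub> x = x" if "x \<in> carrier ?G" for x
      using that by (cases x) (auto simp: car mul one_inversion_semidirect)
    show "\<exists>y\<in>carrier ?G. y \<otimes>\<^bsub>?G\<^esub> x = \<one>\<^bsub>?G\<^esub>" if "x \<in> carrier ?G" for x
    proof -
      obtain a i where x: "x = (a, i)" "a \<in> {0..<int q}" "i \<in> {0..<int n}"
        using \<open>x \<in> carrier ?G\<close> by (auto simp: car)
      let ?y = "((if even i then - a else a) mod int q, (- i) mod int n)"
      have "?y \<in> carrier ?G"
        using q n by (auto simp: car)
      moreover have "?y \<otimes>\<^bsub>?G\<^esub> x = \<one>\<^bsub>?G\<^esub>"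
        using x(2,3) unfolding x(1) by (simp add: mul par one_inversion_semidirect mod_simps)
      ultimately show ?thesis by blast
    qed
  qed
qed

lemma inversion_semidirect_presentation:
  fixes q n :: nat
  defines "G \<equiv> inversion_semidirect q n"
  defines "\<sigma> \<equiv> (0, 1)" and "\<tau> \<equiv> (1, 0)"
  assumes q: "q > 1" and n: "n > 0" "even n"
  shows "\<sigma> \<in> carrier G" "\<tau> \<in> carrier G"
    and "\<sigma> [^]\<^bsub>G\<^esub> n = \<one>\<^bsub>G\<^esub>" "\<tau> [^]\<^bsub>G\<^esub> q = \<one>\<^bsub>G\<^esub>"
    and "\<sigma> \<otimes>\<^bsub>G\<^esub> \<tau> \<otimes>\<^bsub>G\<^esub> inv\<^bsub>G\<^esub> \<sigma> = inv\<^bsub>G\<^esub> \<tau>"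
    and "generate G {\<sigma>, \<tau>} = carrier G"
proof -
  have q0: "q > 0" using q by simp
  have n1: "n > 1" using n by (metis even_Suc gr0_implies_Suc less_Suc_eq_0_disj odd_one neq0_conv One_nat_def)
  interpret G: group G
    unfolding G_def by (rule group_inversion_semidirect[OF q0 n])
  note car = carrier_inversion_semidirect[OF q0 n(1), folded G_def]
  note mul = mult_inversion_semidirect[OF q0, where n = n, folded G_def]
  note one = one_inversion_semidirect[of q n, folded G_def]
  show s: "\<sigma> \<in> carrier G" and t: "\<tau> \<in> carrier G"
    using q n1 by (auto simp: car \<sigma>_def \<tau>_def)
  have ps: "\<sigma> [^]\<^bsub>G\<^esub> k = (0, int k mod int n)" for k :: nat
    using q0 by (induction k) (simp_all add: one mul \<sigma>_def mod_simps algebra_simps)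
  have pt: "\<tau> [^]\<^bsub>G\<^esub> k = (int k mod int q, 0)" for k :: nat
    using q by (induction k) (simp_all add: one mul \<tau>_def mod_simps algebra_simps)
  show "\<sigma> [^]\<^bsub>G\<^esub> n = \<one>\<^bsub>G\<^esub>" "\<tau> [^]\<^bsub>G\<^esub> q = \<one>\<^bsub>G\<^esub>"
    by (simp_all add: ps pt one)
  have "\<tau> \<otimes>\<^bsub>G\<^esub> (\<sigma> \<otimes>\<^bsub>G\<^esub> \<tau>) = \<sigma>"
    using q n1 by (simp add: \<sigma>_def \<tau>_def mul mod_simps)
  then have "\<sigma> \<otimes>\<^bsub>G\<^esub> \<tau> = inv\<^bsub>G\<^esub> \<tau> \<otimes>\<^bsub>G\<^esub> \<sigma>"
    using s t by (metis G.inv_solve_left G.m_closed)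
  then show "\<sigma> \<otimes>\<^bsub>G\<^esub> \<tau> \<otimes>\<^bsub>G\<^esub> inv\<^bsub>G\<^esub> \<sigma> = inv\<^bsub>G\<^esub> \<tau>"
    using s t by (simp add: G.m_assoc)
  have sub: "subgroup (generate G {\<sigma>, \<tau>}) G"
    using s t by (intro G.generate_is_subgroup) auto
  show "generate G {\<sigma>, \<tau>} = carrier G"
  proof
    show "generate G {\<sigma>, \<tau>} \<subseteq> carrier G"
      using sub by (rule subgroup.subset)
    show "carrier G \<subseteq> generate G {\<sigma>, \<tau>}"
    proof
      fix x assume "x \<in> carrier G"
      then obtain a i where x: "x = (a, i)" "0 \<le> a" "a < int q" "0 \<le> i" "i < int n"
        by (auto simp: car)
      have "x = (\<tau> [^]\<^bsub>G\<^esub> nat a) \<otimes>\<^bsub>G\<^esub> (\<sigma> [^]\<^bsub>G\<^esub> nat i)"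
        using x q0 by (simp add: ps pt mul)
      moreover have "y [^]\<^bsub>G\<^esub> (k::nat) \<in> generate G {\<sigma>, \<tau>}" if "y \<in> {\<sigma>, \<tau>}" for y k
        using that
        by (induction k) (auto intro: generate.intros)
      ultimately show "x \<in> generate G {\<sigma>, \<tau>}"
        by (simp add: generate.eng)
    qed
  qed
qed

end

theory Submission
  imports Defs "HOL-Number_Theory.Residues"
begin

text \<open>
  Both additive groups are extensions of a group of order 4, written with two bits \<open>(u, v)\<close>, by
  $\mathbb{Z}_q$, and $(0,0,1)$ is the only central involution. An automorphism is therefore
  $(x,u,v) \mapsto (mx + tu, u, v + wu)$, so the map $\lambda$ of a skew brace is given by three
  functions $m, t, w$ on $B$. A fixed point argument gives $m = 1$ on the Sylow \<open>q\<close>-subgroup $P$; since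
  fourth powers lie in $P$ and $-1$ is not a square modulo \<open>q\<close>, $m = \pm 1$. On $P$ the function
  $t$ is $x \mapsto \tau x$ with $\tau \in \{0, -2\}$, and a translation of the coordinates
  removes the rest of $t$. What remains are the sign characters of a group of order 4
  (\<open>i\<close>, \<open>j\<close>), the carry bit \<open>f\<close> of the multiplication of bits and the bit \<open>d\<close> with $1 + \tau = (-1)^d$;
  these are invariants, except that \<open>i\<close> can be cleared when \<open>j\<close> is set.
\<close>

text \<open>In a skew brace a o b = a + lambda_a(b), and lambda is a homomorphism from (B,o) to the
  automorphisms of (B,+). So \<open>m\<close> and \<open>w\<close> are characters of (B,o) and
  \<open>t\<close> is a crossed homomorphism, all determined by their values on P and at two lifts
  of the bits. The two values of tau come from evaluating \<open>t\<close> in two ways at the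
  product of a generator of P and a lift of \<open>u\<close>: this gives tau (tau + 2) = 0. What is
  left of \<open>t\<close> is removed by solving equations with coefficients 0 or +-2, which is
  possible because q is odd. The carry of o is the carry of + changed by \<open>w\<close>, so it can
  be chosen freely; this is why both additive groups have the same counts. Multiplying x by
  (-1)^(du) turns the multiplication of a model into the extension with sign (-1)^((1+i+d)u + jv),
  so the type of (B,o) records only \<open>f\<close> and whether this character is trivial. Each
  count is the number of triples (i,j,d) with these data: two have j = 0, and the case j = 1, which
  a carry forbids, adds two more for the dihedral type.\<close>

lemma iso_of_bij:
  assumes "bij_betw h (carrier G) (carrier H)"
    and "\<And>x y. x \<in> carrier G \<Longrightarrow> y \<in> carrier G \<Longrightarrow> h (x \<otimes>\<^bsub>G\<^esub> y) = h x \<otimes>\<^bsub>H\<^esub> h y"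
  shows "h \<in> iso G H"
  using assms by (auto simp: iso_def hom_def bij_betw_def)

section \<open>Extensions of four bit pairs by Z_q, and the model skew braces\<close>

definition sg :: "bool \<Rightarrow> int" where
  "sg b = (if b then - 1 else 1)"

lemma sg_simps [simp]: "sg True = - 1" "sg False = 1" "sg b * sg b = 1" "sg b * (sg b * x) = x"
  by (auto simp: sg_def)

lemma sg_xor: "sg (a \<noteq> b) = sg a * sg b"
  by (auto simp: sg_def)

text \<open>Removes a reduction hidden behind a sign coefficient, so that the group laws become
  identities of integers.\<close>

lemma mod_lin:
  fixes a k y n :: int
  shows "(a + k * (y mod n)) mod n = (a + k * y) mod n" "(k * (y mod n) + a) mod n = (k * y + a) mod n"
  by (metis mod_add_right_eq mod_mult_right_eq, metis mod_add_left_eq mod_mult_right_eq)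

text \<open>
  The bits \<open>(u, v)\<close> form $\mathbb{Z}_4$ (as $u + 2v$) if the carry bit \<open>f\<close> is set, and
  $\mathbb{Z}_2^2$ otherwise; they act on $\mathbb{Z}_q$ by $(-1)^{iu + jv}$, which is a character
  unless both \<open>f\<close> and \<open>j\<close> are set.
\<close>

definition ext_carrier :: "nat \<Rightarrow> (int \<times> bool \<times> bool) set" where
  "ext_carrier q = {0..<int q} \<times> UNIV"

definition ext_mult ::
  "nat \<Rightarrow> bool \<Rightarrow> bool \<Rightarrow> bool \<Rightarrow> int \<times> bool \<times> bool \<Rightarrow> int \<times> bool \<times> bool \<Rightarrow> int \<times> bool \<times> bool" where
  "ext_mult q f i j = (\<lambda>(x, u, v) (x', u', v').
     ((x + sg ((i \<and> u) \<noteq> (j \<and> v)) * x') mod int q, u \<noteq> u', (v \<noteq> v') \<noteq> (f \<and> u \<and> u')))"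

definition ext_group :: "nat \<Rightarrow> bool \<Rightarrow> bool \<Rightarrow> bool \<Rightarrow> (int \<times> bool \<times> bool) monoid" where
  "ext_group q f i j =
    \<lparr>carrier = ext_carrier q, monoid.mult = ext_mult q f i j, one = (0, False, False)\<rparr>"

text \<open>The product is \<open>a + lambda_a b\<close>, where lambda_a multiplies x' by
  (-1)^(iu+jv) and, if u' is set, adds (-1)^u ((-1)^d - 1) x. The outer sign (-1)^u of the addition
  cancels the one in the last term, which leaves the factor (-1)^d on x.\<close>

definition model :: "nat \<Rightarrow> bool \<Rightarrow> bool \<Rightarrow> bool \<Rightarrow> bool \<Rightarrow> bool \<Rightarrow> (int \<times> bool \<times> bool) ring" where
  "model q e f i j d =
    \<lparr>carrier = ext_carrier q,
     monoid.mult = (\<lambda>(x, u, v) (x', u', v').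
       ((sg (d \<and> u') * x + sg (u \<noteq> ((i \<and> u) \<noteq> (j \<and> v))) * x') mod int q,
        u \<noteq> u', (v \<noteq> v') \<noteq> (f \<and> u \<and> u'))),
     one = (0, False, False), zero = (0, False, False), add = ext_mult q e True False\<rparr>"

lemma ext_group_simps:
  "carrier (ext_group q f i j) = ext_carrier q"
  "\<one>\<^bsub>ext_group q f i j\<^esub> = (0, False, False)"
  "(x, u, v) \<otimes>\<^bsub>ext_group q f i j\<^esub> (x', u', v') =
    ((x + sg ((i \<and> u) \<noteq> (j \<and> v)) * x') mod int q, u \<noteq> u', (v \<noteq> v') \<noteq> (f \<and> u \<and> u'))"
  "(x, u, v) \<in> ext_carrier q \<longleftrightarrow> 0 \<le> x \<and> x < int q"
  by (auto simp: ext_group_def ext_mult_def ext_carrier_def)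

lemma model_simps:
  "carrier (model q e f i j d) = ext_carrier q"
  "\<one>\<^bsub>model q e f i j d\<^esub> = (0, False, False)"
  "(x, u, v) \<otimes>\<^bsub>model q e f i j d\<^esub> (x', u', v') =
    ((sg (d \<and> u') * x + sg (u \<noteq> ((i \<and> u) \<noteq> (j \<and> v))) * x') mod int q,
        u \<noteq> u', (v \<noteq> v') \<noteq> (f \<and> u \<and> u'))"
  "add_monoid (model q e f i j d) = ext_group q e True False"
  by (auto simp: model_def ext_group_def)

lemma group_ext_group:
  assumes q: "q > 0" and fj: "j \<longrightarrow> \<not> f"
  shows "group (ext_group q f i j)" (is "group ?G")
proof (rule groupI)
  show "x \<otimes>\<^bsub>?G\<^esub> y \<in> carrier ?G" if "x \<in> carrier ?G" "y \<in> carrier ?G" for x y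
    using that q by (cases x; cases y) (auto simp: ext_group_simps)
  show "\<one>\<^bsub>?G\<^esub> \<in> carrier ?G"
    using q by (simp add: ext_group_simps)
  show "x \<otimes>\<^bsub>?G\<^esub> y \<otimes>\<^bsub>?G\<^esub> z = x \<otimes>\<^bsub>?G\<^esub> (y \<otimes>\<^bsub>?G\<^esub> z)"
    if "x \<in> carrier ?G" "y \<in> carrier ?G" "z \<in> carrier ?G" for x y z
  proof -
    obtain a u v b u' v' c u'' v'' where *: "x = (a, u, v)" "y = (b, u', v')" "z = (c, u'', v'')"
      by (metis prod_cases3)
    \<comment> \<open>The exponent of the sign is additive in the bits: the carry changes only the
      bit \<open>v\<close>, whose sign is trivial whenever a carry exists.\<close>
    have "((i \<and> (u \<noteq> u')) \<noteq> (j \<and> ((v \<noteq> v') \<noteq> (f \<and> u \<and> u')))) =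
        (((i \<and> u) \<noteq> (j \<and> v)) \<noteq> ((i \<and> u') \<noteq> (j \<and> v')))"
      using fj by auto
    then have sg: "sg ((i \<and> (u \<noteq> u')) \<noteq> (j \<and> ((v \<noteq> v') \<noteq> (f \<and> u \<and> u')))) =
        sg ((i \<and> u) \<noteq> (j \<and> v)) * sg ((i \<and> u') \<noteq> (j \<and> v'))"
      by (simp only: sg_xor)
    show ?thesis
      unfolding * ext_group_simps sg
      by (auto simp: mod_lin mod_simps) (simp add: algebra_simps)
  qed
  show "\<one>\<^bsub>?G\<^esub> \<otimes>\<^bsub>?G\<^esub> x = x" if "x \<in> carrier ?G" for x
    using that by (cases x) (auto simp: ext_group_simps)
  show "\<exists>y\<in>carrier ?G. y \<otimes>\<^bsub>?G\<^esub> x = \<one>\<^bsub>?G\<^esub>" if "x \<in> carrier ?G" for x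
  proof -
    obtain a u v where x: "x = (a, u, v)"
      by (metis prod_cases3)
    \<comment> \<open>Adding \<open>u\<close> to itself produces the carry \<open>f\<close>, which
      the bit \<open>v\<close> of the inverse has to absorb.\<close>
    let ?v = "v \<noteq> (f \<and> u)"
    let ?y = "((- sg ((i \<and> u) \<noteq> (j \<and> ?v)) * a) mod int q, u, ?v)"
    have "?y \<in> carrier ?G"
      using q by (simp add: ext_group_simps)
    moreover have "?y \<otimes>\<^bsub>?G\<^esub> x = \<one>\<^bsub>?G\<^esub>"
      unfolding x ext_group_simps by (auto simp: mod_simps)
    ultimately show ?thesis by blast
  qed
qed

text \<open>The rescaling, an involution, absorbs the factor (-1)^(du') that stands on x. The sign
  on x' then has exponent (1+i+d)u + jv, and 1+i+d is odd exactly if \<open>i = d\<close>.\<close>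

lemma model_mult_iso:
  assumes q: "q > 0"
  shows "(\<lambda>(x, u, v). ((sg (d \<and> u) * x) mod int q, u, v)) \<in>
    iso (ext_group q f (i = d) j) (model q e f i j d)" (is "?h \<in> iso ?G ?M")
proof -
  have inv: "?h (?h a) = a" "?h a \<in> ext_carrier q" if "a \<in> ext_carrier q" for a
    using that q by (auto simp: ext_carrier_def mod_simps)
  have "bij_betw ?h (carrier ?G) (carrier ?M)"
    unfolding ext_group_simps model_simps
    using inv by (intro bij_betw_byWitness[where f' = ?h]) auto
  then show ?thesis
  proof (rule iso_of_bij)
    fix a b
    show "?h (a \<otimes>\<^bsub>?G\<^esub> b) = ?h a \<otimes>\<^bsub>?M\<^esub> ?h b"
    proof -
      obtain x u v x' u' v' where *: "a = (x, u, v)" "b = (x', u', v')"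
        by (metis prod_cases3)
      show ?thesis
        unfolding * ext_group_simps model_simps prod.case mod_lin mod_mult_right_eq
        by (auto simp: sg_def algebra_simps minus_diff_commute)
    qed
  qed
qed

text \<open>The multiplicative group axioms are transported along \<open>model_mult_iso\<close>;
  only the brace law needs a computation with the explicit additive inverse.\<close>

lemma skew_brace_model:
  assumes q: "q > 0" and fj: "j \<longrightarrow> \<not> f"
  shows "skew_brace (model q e f i j d)" (is "skew_brace ?M")
proof (intro skew_brace.intro skew_brace_axioms.intro)
  let ?G = "ext_group q f (i = d) j"
  let ?A = "ext_group q e True False"
  note iso = model_mult_iso[OF q, of d f i j e]
  show "group ?M"
  proof (rule group_transport[OF group_ext_group[OF q fj, of "i = d"]])
    let ?h = "\<lambda>(x, u, v). ((sg (d \<and> u) * x) mod int q, u, v)"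
    show "bij_betw ?h (carrier ?G) (carrier ?M)"
      using iso by (simp add: iso_def)
    show "?h (x \<otimes>\<^bsub>?G\<^esub> y) = ?h x \<otimes>\<^bsub>?M\<^esub> ?h y" if "x \<in> carrier ?G" "y \<in> carrier ?G" for x y
      using iso that by (simp add: iso_def hom_def)
    show "?h \<one>\<^bsub>?G\<^esub> = \<one>\<^bsub>?M\<^esub>"
      by (simp add: ext_group_simps model_simps)
  qed
  show A: "group (add_monoid ?M)"
    unfolding model_simps(4) by (rule group_ext_group[OF q]) simp
  fix a b c assume abc: "a \<in> carrier ?M" "b \<in> carrier ?M" "c \<in> carrier ?M"
  obtain x u v x' u' v' x'' u'' v'' where *: "a = (x, u, v)" "b = (x', u', v')" "c = (x'', u'', v'')"
    by (metis prod_cases3)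
  have "inv\<^bsub>?A\<^esub> (x, u, v) = ((- sg u * x) mod int q, u, v \<noteq> (e \<and> u))"
    using abc(1) q by (intro group.inv_equality[OF A[unfolded model_simps(4)]])
      (auto simp: * ext_group_simps model_simps mod_simps)
  then have neg: "\<ominus>\<^bsub>?M\<^esub> (x, u, v) = ((- sg u * x) mod int q, u, v \<noteq> (e \<and> u))"
    unfolding a_inv_def model_simps(4) .
  have add: "k \<oplus>\<^bsub>?M\<^esub> l = k \<otimes>\<^bsub>?A\<^esub> l" for k l
    by (simp add: model_def ext_group_def)
  show "a \<otimes>\<^bsub>?M\<^esub> (b \<oplus>\<^bsub>?M\<^esub> c) = a \<otimes>\<^bsub>?M\<^esub> b \<oplus>\<^bsub>?M\<^esub> (\<ominus>\<^bsub>?M\<^esub> a) \<oplus>\<^bsub>?M\<^esub> (a \<otimes>\<^bsub>?M\<^esub> c)"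
    unfolding * neg add ext_group_simps model_simps
    unfolding mod_lin mod_add_left_eq mod_add_right_eq
    by (auto simp: sg_def algebra_simps minus_diff_commute)
qed

section \<open>The multiplicative and additive groups\<close>

lemma ext_group_iso_Dic:
  assumes q: "q > 0"
  shows "ext_group q True True False \<cong> inversion_semidirect q 4" (is "?G \<cong> ?H")
proof -
  define h :: "int \<times> bool \<times> bool \<Rightarrow> int \<times> int" where
    "h = (\<lambda>(x, u, v). (x, of_bool u + 2 * of_bool v))"
  define g :: "int \<times> int \<Rightarrow> int \<times> bool \<times> bool" where
    "g = (\<lambda>(x, n). (x, odd n, n \<ge> 2))"
  have four: "n = 0 \<or> n = 1 \<or> n = 2 \<or> n = 3" if "n \<in> {0..<4}" for n :: int
    using that by auto
  have "h \<in> iso ?G ?H"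
  proof (rule iso_of_bij)
    show "bij_betw h (carrier ?G) (carrier ?H)"
    proof (rule bij_betw_byWitness[where f' = g])
      show "\<forall>b\<in>carrier ?H. h (g b) = b"
        using q by (auto simp: carrier_inversion_semidirect h_def g_def dest!: four)
    qed (use q in \<open>auto simp: carrier_inversion_semidirect h_def g_def ext_group_def ext_carrier_def\<close>)
    show "h (a \<otimes>\<^bsub>?G\<^esub> b) = h a \<otimes>\<^bsub>?H\<^esub> h b" if "a \<in> carrier ?G" "b \<in> carrier ?G" for a b
      using that q
      by (cases a; cases b)
        (auto simp: h_def ext_group_simps mult_inversion_semidirect sg_def)
  qed
  then show ?thesis by (auto simp: is_iso_def)
qed

text \<open>Without a carry the bits form a plane over F_2. The value of the nontrivial character is
  one coordinate of it, acting on Z_q; a second coordinate, \<open>u\<close> if \<open>j\<close> is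
  set and \<open>v\<close> otherwise, splits off as the direct factor.\<close>

lemma ext_group_iso_Z2Dih:
  assumes q: "q > 0" and ij: "i \<or> j"
  shows "ext_group q False i j \<cong> integer_mod_group 2 \<times>\<times> inversion_semidirect q 2" (is "?G \<cong> ?H")
proof -
  have two: "n = 0 \<or> n = 1" if "n \<in> {0..<2}" for n :: int
    using that by auto
  define h :: "int \<times> bool \<times> bool \<Rightarrow> int \<times> int \<times> int" where
    "h = (\<lambda>(x, u, v). if j then (of_bool u, x, of_bool ((i \<and> u) \<noteq> v)) else (of_bool v, x, of_bool u))"
  define g :: "int \<times> int \<times> int \<Rightarrow> int \<times> bool \<times> bool" where
    "g = (\<lambda>(m, x, n). if j then (x, m = 1, (i \<and> m = 1) \<noteq> (n = 1)) else (x, n = 1, m = 1))"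
  have "h \<in> iso ?G ?H"
  proof (rule iso_of_bij)
    show "bij_betw h (carrier ?G) (carrier ?H)"
    proof (rule bij_betw_byWitness[where f' = g])
      show "\<forall>b\<in>carrier ?H. h (g b) = b"
        using q
        by (auto simp: carrier_inversion_semidirect carrier_integer_mod_group h_def g_def dest!: two)
    qed (use q in \<open>auto simp: carrier_inversion_semidirect carrier_integer_mod_group h_def g_def
           ext_group_def ext_carrier_def split: if_splits\<close>)
    show "h (a \<otimes>\<^bsub>?G\<^esub> b) = h a \<otimes>\<^bsub>?H\<^esub> h b" if "a \<in> carrier ?G" "b \<in> carrier ?G" for a b
      using that q ij
      by (cases a; cases b)
        (auto simp: h_def ext_group_simps mult_inversion_semidirect sg_def)
  qed
  then show ?thesis by (auto simp: is_iso_def)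
qed

lemma ext_group_iso_Z22q:
  assumes q: "q > 0"
  shows "ext_group q False False False \<cong>
    (integer_mod_group 2 \<times>\<times> integer_mod_group 2) \<times>\<times> integer_mod_group q" (is "?G \<cong> ?H")
proof -
  have two: "n = 0 \<or> n = 1" if "n \<in> {0..<2}" for n :: int
    using that by auto
  define h :: "int \<times> bool \<times> bool \<Rightarrow> (int \<times> int) \<times> int" where
    "h = (\<lambda>(x, u, v). ((of_bool u, of_bool v), x))"
  define g :: "(int \<times> int) \<times> int \<Rightarrow> int \<times> bool \<times> bool" where
    "g = (\<lambda>((m, n), x). (x, m = 1, n = 1))"
  have "h \<in> iso ?G ?H"
  proof (rule iso_of_bij)
    show "bij_betw h (carrier ?G) (carrier ?H)"
    proof (rule bij_betw_byWitness[where f' = g])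
      show "\<forall>b\<in>carrier ?H. h (g b) = b"
        using q by (auto simp: carrier_integer_mod_group h_def g_def dest!: two)
    qed (use q in \<open>auto simp: carrier_integer_mod_group h_def g_def ext_group_def ext_carrier_def\<close>)
    show "h (a \<otimes>\<^bsub>?G\<^esub> b) = h a \<otimes>\<^bsub>?H\<^esub> h b" if "a \<in> carrier ?G" "b \<in> carrier ?G" for a b
      using that by (cases a; cases b) (auto simp: h_def ext_group_simps)
  qed
  then show ?thesis by (auto simp: is_iso_def)
qed

lemma coprime_4_odd:
  assumes "odd q"
  shows "coprime 4 (int q)"
proof -
  have "coprime (int q) 2"
    using assms by (simp add: coprime_right_2_iff_odd)
  then have "coprime (int q) (2 * 2)"
    by (simp only: coprime_mult_right_iff)
  then show ?thesis
    by (simp add: coprime_commute)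
qed

text \<open>Chinese remainders, with the residue modulo 4 written as its two binary digits. The map
  is built from the cyclic group, where it is a reduction, and then inverted.\<close>

lemma ext_group_iso_Z4q:
  assumes q: "odd q"
  shows "ext_group q True False False \<cong> integer_mod_group (4 * q)" (is "?G \<cong> ?H")
proof -
  have q0: "q > 0" using q by (cases q) auto
  define h :: "int \<Rightarrow> int \<times> bool \<times> bool" where
    "h = (\<lambda>n. (n mod int q, odd n, odd (n div 2)))"
  have hmod: "h (n mod (4 * int q)) = h n" for n
  proof -
    \<comment> \<open>Reduction modulo 4q subtracts a multiple of 4, so both binary digits
      survive.\<close>
    define t where "t = int q * (n div (4 * int q))"
    have "n mod (4 * int q) = n - 4 * t"
      by (simp add: t_def minus_mult_div_eq_mod[symmetric])
    moreover have "even (n - 4 * t) = even n" "even ((n - 4 * t) div 2) = even (n div 2)"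
      by presburger+
    moreover have "n mod (4 * int q) mod int q = n mod int q"
      by (simp add: mod_mod_cancel)
    ultimately show ?thesis
      by (simp add: h_def)
  qed
  have hadd: "h (n + m) = h n \<otimes>\<^bsub>?G\<^esub> h m" for n m
    unfolding h_def ext_group_simps
    by (simp add: mod_simps) presburger
  have "inj_on h {0..<4 * int q}"
  proof (rule inj_onI)
    fix n m assume nm: "n \<in> {0..<4 * int q}" "m \<in> {0..<4 * int q}" and eq: "h n = h m"
    have "[n = m] (mod 4)"
    proof -
      have "odd n = odd m" "odd (n div 2) = odd (m div 2)"
        using eq by (simp_all add: h_def)
      then show ?thesis
        unfolding cong_def by presburger
    qed
    moreover have "[n = m] (mod int q)"
      using eq by (simp add: h_def cong_def)
    moreover have "coprime 4 (int q)"
      using q by (rule coprime_4_odd)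
    ultimately have "[n = m] (mod (4 * int q))"
      by (rule coprime_cong_mult)
    then show "n = m"
      using nm by (simp add: cong_def)
  qed
  moreover have "h ` {0..<4 * int q} \<subseteq> ext_carrier q"
    using q0 by (auto simp: h_def ext_carrier_def)
  moreover have "card (UNIV :: (bool \<times> bool) set) = 4"
    by (simp flip: UNIV_Times_UNIV add: card_cartesian_product)
  then have "card (ext_carrier q) = 4 * q" "finite (ext_carrier q)"
    by (simp_all add: ext_carrier_def card_cartesian_product)
  ultimately have "bij_betw h {0..<4 * int q} (ext_carrier q)"
    by (simp add: bij_betw_def card_image card_subset_eq)
  then have "h \<in> iso ?H ?G"
    using q0 by (intro iso_of_bij)
      (simp_all add: carrier_integer_mod_group ext_group_simps hadd[symmetric] hmod)
  then have "?H \<cong> ?G" by (auto simp: is_iso_def)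
  then show ?thesis
    by (rule group.iso_sym[OF group_integer_mod_group])
qed

section \<open>Automorphisms of the additive groups\<close>

lemma odd_dvd_double:
  fixes m :: int
  assumes "odd q" "int q dvd 2 * m"
  shows "int q dvd m"
proof -
  have "coprime (int q) 2"
    using assms by (simp add: coprime_right_2_iff_odd)
  then show ?thesis
    using assms by (simp add: coprime_dvd_mult_right_iff)
qed

text \<open>The elements (1,0,0), (0,0,1) and (0,1,0) generate the group, and each is restricted by
  a property that injective endomorphisms respect: being a fourth power, being an involution that
  commutes with (1,0,0), and not commuting with (1,0,0).\<close>

lemma ext_automorphism_form:
  assumes q: "prime q" "odd q"
    and hom: "\<phi> \<in> hom (ext_group q e True False) (ext_group q e True False)"
    and inj: "inj_on \<phi> (ext_carrier q)"
  obtains m t w where "0 < m" "m < int q" "0 \<le> t" "t < int q"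
    "\<And>x u v. 0 \<le> x \<Longrightarrow> x < int q \<Longrightarrow>
      \<phi> (x, u, v) = ((m * x + (if u then t else 0)) mod int q, u, v \<noteq> (w \<and> u))"
proof -
  let ?A = "ext_group q e True False"
  let ?o = "(0, False, False) :: int \<times> bool \<times> bool"
  have q2: "q > 2"
    using q prime_ge_2_nat[OF q(1)] by (cases "q = 2") auto
  note m3 = ext_group_simps(3)[where q = q and f = e and i = True and j = False]
  have car: "(x, u, v) \<in> carrier ?A \<longleftrightarrow> 0 \<le> x \<and> x < int q" for x u v
    by (simp add: ext_group_simps)
  interpret A: group ?A
    using q2 by (intro group_ext_group) auto
  interpret \<phi>: group_hom ?A ?A \<phi>
    by unfold_locales (rule hom)
  have closed: "0 \<le> x \<and> x < int q" if "\<phi> a = (x, u, v)" "a \<in> carrier ?A" for a x u v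
    using \<phi>.hom_closed[OF that(2)] unfolding that(1) by (simp add: car)
  have injD: "a = b" if "\<phi> a = \<phi> b" "a \<in> carrier ?A" "b \<in> carrier ?A" for a b
    using inj that by (simp add: inj_on_def ext_group_simps(1))
  have phi0: "\<phi> ?o = ?o"
    using \<phi>.hom_one by (simp add: ext_group_simps)
  have mult: "\<phi> (a \<otimes>\<^bsub>?A\<^esub> b) = \<phi> a \<otimes>\<^bsub>?A\<^esub> \<phi> b" if "a \<in> carrier ?A" "b \<in> carrier ?A" for a b
    using that by (rule \<phi>.hom_mult)
  obtain c where c: "[4 * c = 1] (mod int q)"
    using cong_solve_coprime_int[OF coprime_4_odd[OF q(2)]] by blast
  have phi1: "\<exists>m. \<phi> (1, False, False) = (m, False, False)"
  proof -
    let ?b = "(c mod int q, False, False)"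
    have b: "?b \<in> carrier ?A"
      using q2 by (simp add: car)
    \<comment> \<open>Since 4 is invertible modulo q, this generator is a fourth power, and all
      fourth powers have both bits clear.\<close>
    have "(1, False, False) = (?b \<otimes>\<^bsub>?A\<^esub> ?b) \<otimes>\<^bsub>?A\<^esub> (?b \<otimes>\<^bsub>?A\<^esub> ?b)"
      using c q2 by (simp add: m3 mod_simps cong_def)
    then have "\<phi> (1, False, False) = (\<phi> ?b \<otimes>\<^bsub>?A\<^esub> \<phi> ?b) \<otimes>\<^bsub>?A\<^esub> (\<phi> ?b \<otimes>\<^bsub>?A\<^esub> \<phi> ?b)"
      using b by (simp add: mult)
    then show ?thesis
      by (cases "\<phi> ?b") (auto simp: m3)
  qed
  then obtain m where m: "\<phi> (1, False, False) = (m, False, False)"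
    by blast
  have one: "(1, False, False) \<in> carrier ?A"
    using q2 by (simp add: car)
  have z: "(0, False, True) \<in> carrier ?A" and g: "(0, True, False) \<in> carrier ?A"
    using q2 by (simp_all add: car)
  have mrange: "0 \<le> m" "m < int q"
    using closed[OF m one] by auto
  have m0: "m \<noteq> 0"
  proof
    assume "m = 0"
    then have "(1, False, False) = ?o"
      using m phi0 q2 by - (rule injD, auto simp: car)
    then show False by simp
  qed
  have phiP: "\<phi> (int n mod int q, False, False) = ((m * int n) mod int q, False, False)" for n
  proof (induction n)
    case (Suc n)
    have "(int (Suc n) mod int q, False, False) = (int n mod int q, False, False) \<otimes>\<^bsub>?A\<^esub> (1, False, False)"
      by (simp add: m3 mod_simps algebra_simps)
    then have "\<phi> (int (Suc n) mod int q, False, False) =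
        ((m * int n) mod int q, False, False) \<otimes>\<^bsub>?A\<^esub> (m, False, False)"
      using one q2 by (simp add: mult Suc m car)
    then show ?case
      by (simp add: m3 mod_simps algebra_simps)
  qed (simp add: phi0)
  \<comment> \<open>The image commutes with (m,0,0), which clears \<open>u\<close>; it squares to
    the identity, so its first coordinate satisfies 2y = 0; injectivity then sets
    \<open>v\<close>.\<close>
  have phiz: "\<phi> (0, False, True) = (0, False, True)"
  proof -
    obtain y u v where yuv: "\<phi> (0, False, True) = (y, u, v)"
      by (metis prod_cases3)
    have "(0, False, True) \<otimes>\<^bsub>?A\<^esub> (1, False, False) = (1, False, False) \<otimes>\<^bsub>?A\<^esub> (0, False, True)"
      by (simp add: m3)
    then have "(y, u, v) \<otimes>\<^bsub>?A\<^esub> (m, False, False) = (m, False, False) \<otimes>\<^bsub>?A\<^esub> (y, u, v)"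
      using one z by (metis mult m yuv)
    then have eq: "(y + sg u * m) mod int q = (m + y) mod int q"
      by (simp add: m3)
    have nu: "\<not> u"
    proof
      assume u
      then have "int q dvd (m + y) - (y + sg u * m)"
        using eq by (metis mod_eq_dvd_iff)
      then have "int q dvd 2 * m"
        using \<open>u\<close> by simp
      then have "int q dvd m"
        by (rule odd_dvd_double[OF q(2)])
      then show False
        using mrange m0 zdvd_imp_le[of "int q" m] by auto
    qed
    have "(0, False, True) \<otimes>\<^bsub>?A\<^esub> (0, False, True) = ?o"
      by (simp add: m3)
    then have "(y, u, v) \<otimes>\<^bsub>?A\<^esub> (y, u, v) = ?o"
      using z by (metis mult yuv phi0)
    then have "int q dvd 2 * y"
      using nu by (simp add: m3 mod_eq_0_iff_dvd)
    then have "int q dvd y"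
      by (rule odd_dvd_double[OF q(2)])
    then have "y = 0"
      using closed[OF yuv z] zdvd_imp_le[of "int q" y] by fastforce
    moreover have v
    proof (rule ccontr)
      assume "\<not> v"
      then have "(0, False, True) = ?o"
        using yuv nu \<open>y = 0\<close> z phi0 q2 by - (rule injD, auto simp: car)
      then show False by simp
    qed
    ultimately show ?thesis
      using yuv nu by simp
  qed
  obtain t u w where tuw: "\<phi> (0, True, False) = (t, u, w)"
    by (metis prod_cases3)
  \<comment> \<open>If \<open>u\<close> were clear, the image would commute with (m,0,0), and by
    injectivity (0,1,0) would commute with (1,0,0), which it inverts.\<close>
  have u
  proof (rule ccontr)
    assume nu: "\<not> u"
    have "(t, u, w) \<otimes>\<^bsub>?A\<^esub> (m, False, False) = (m, False, False) \<otimes>\<^bsub>?A\<^esub> (t, u, w)"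
      using nu by (simp add: m3 add.commute)
    then have "\<phi> ((0, True, False) \<otimes>\<^bsub>?A\<^esub> (1, False, False)) = \<phi> ((1, False, False) \<otimes>\<^bsub>?A\<^esub> (0, True, False))"
      using one g by (simp add: mult m tuw)
    then have "(0, True, False) \<otimes>\<^bsub>?A\<^esub> (1, False, False) = (1, False, False) \<otimes>\<^bsub>?A\<^esub> (0, True, False)"
      using one g by - (rule injD, auto)
    then have "(- 1) mod int q = 1"
      using q2 by (simp add: m3)
    then show False
      using q2 by (simp add: zmod_minus1)
  qed
  show thesis
  proof (rule that)
    show "0 < m" "m < int q"
      using mrange m0 by auto
    show "0 \<le> t" "t < int q"
      using closed[OF tuw g] by auto
    fix x :: int and u' v assume x: "0 \<le> x" "x < int q"
    have P: "\<phi> (x, False, False) = ((m * x) mod int q, False, False)"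
      using phiP[of "nat x"] x by simp
    have Z: "\<phi> (0, False, v) = (0, False, v)"
      using phiz phi0 by (cases v) auto
    have G: "\<phi> (0, u', False) = (if u' then t else 0, u', w \<and> u')"
      using tuw \<open>u\<close> phi0 by (cases u') auto
    have "(x, u', v) = ((x, False, False) \<otimes>\<^bsub>?A\<^esub> (0, False, v)) \<otimes>\<^bsub>?A\<^esub> (0, u', False)"
      using x by (simp add: m3)
    then have "\<phi> (x, u', v) =
        (((m * x) mod int q, False, False) \<otimes>\<^bsub>?A\<^esub> (0, False, v)) \<otimes>\<^bsub>?A\<^esub> (if u' then t else 0, u', w \<and> u')"
      using x q2 by (simp add: mult car P Z G)
    then show "\<phi> (x, u', v) = ((m * x + (if u' then t else 0)) mod int q, u', v \<noteq> (w \<and> u'))"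
      by (simp add: m3 mod_simps)
  qed
qed

section \<open>Normal form of a skew brace\<close>

text \<open>Factor m^4 - 1 = (m-1)(m+1)(m^2+1). If q divided the last factor, raising m^2 = -1 to
  the power (q-1)/2 would contradict Fermat's theorem.\<close>

lemma cong_pow4_eq_1:
  fixes m :: int
  assumes q: "prime q" "[q = 3] (mod 4)" and m: "[m ^ 4 = 1] (mod int q)"
  shows "[m = 1] (mod int q) \<or> [m = - 1] (mod int q)"
proof -
  have "int q dvd (m - 1) * ((m + 1) * (m ^ 2 + 1))"
    using m by (simp add: cong_iff_dvd_diff algebra_simps power2_eq_square power4_eq_xxxx)
  then consider "int q dvd m - 1" | "int q dvd m + 1" | "int q dvd m ^ 2 + 1"
    using q(1) by (auto simp: prime_dvd_mult_iff)
  then show ?thesis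
  proof cases
    case 3
    have q3: "q mod 4 = 3"
      using q(2) by (simp add: cong_def)
    \<comment> \<open>The residue of q modulo 4 enters here: (q-1)/2 is odd.\<close>
    then have "q - 1 = 2 * (2 * (q div 4) + 1)"
      by presburger
    then obtain k where k: "q - 1 = 2 * (2 * k + 1)"
      by blast
    define a where "a = nat (m mod int q)"
    have q0: "q > 0"
      using q(1) prime_gt_0_nat by blast
    have a: "[int a = m] (mod int q)"
      using q0 by (simp add: a_def cong_def)
    have "\<not> q dvd a"
    proof
      assume "q dvd a"
      then have "[m = 0] (mod int q)"
        using a by (metis cong_0_iff cong_trans cong_sym int_dvd_int_iff)
      then have "[m ^ 2 + 1 = 0 ^ 2 + 1] (mod int q)"
        by (intro cong_add cong_pow) auto
      then have "int q dvd 1"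
        using 3 cong_dvd_iff by fastforce
      then show False
        using q(1) by (simp add: prime_nat_iff)
    qed
    then have "[int (a ^ (q - 1)) = int 1] (mod int q)"
      using fermat_theorem[OF q(1)] by (simp only: cong_int_iff)
    moreover have "[int a ^ (q - 1) = m ^ (q - 1)] (mod int q)"
      using a by (rule cong_pow)
    moreover have "[(m ^ 2) ^ (2 * k + 1) = (- 1) ^ (2 * k + 1)] (mod int q)"
      using 3 by (intro cong_pow) (simp add: cong_iff_dvd_diff)
    ultimately have "[1 = - 1] (mod int q)"
      unfolding k power_mult by (simp add: power_mult) (meson cong_sym cong_trans)
    then have "int q dvd 2"
      by (simp add: cong_iff_dvd_diff)
    then have "int q \<le> 2"
      by (rule zdvd_imp_le) simp
    then show ?thesis
      using q3 by (cases "q = 0 \<or> q = 1 \<or> q = 2") auto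
  qed (auto simp: cong_iff_dvd_diff)
qed

lemma sg_cong_iff:
  assumes "q > 2"
  shows "[sg a = sg b] (mod int q) \<longleftrightarrow> a = b"
  using assms zdvd_imp_le[of "int q" 2]
  by (cases a; cases b) (auto simp: cong_iff_dvd_diff)

section \<open>The multiplication of a skew brace in the coordinates of its additive group\<close>

locale ext_brace =
  fixes q :: nat and e :: bool
    and op :: "int \<times> bool \<times> bool \<Rightarrow> int \<times> bool \<times> bool \<Rightarrow> int \<times> bool \<times> bool"  (infixl \<open>\<diamondop>\<close> 70)
  assumes prime: "prime q" and mod4: "[q = 3] (mod 4)"
    and closed: "a \<in> ext_carrier q \<Longrightarrow> b \<in> ext_carrier q \<Longrightarrow> a \<diamondop> b \<in> ext_carrier q"
    and assoc: "\<lbrakk>a \<in> ext_carrier q; b \<in> ext_carrier q; c \<in> ext_carrier q\<rbrakk> \<Longrightarrow>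
      a \<diamondop> b \<diamondop> c = a \<diamondop> (b \<diamondop> c)"
    and cancel: "\<lbrakk>a \<in> ext_carrier q; b \<in> ext_carrier q; c \<in> ext_carrier q; a \<diamondop> b = a \<diamondop> c\<rbrakk> \<Longrightarrow> b = c"
    and law: "\<lbrakk>a \<in> ext_carrier q; b \<in> ext_carrier q; c \<in> ext_carrier q\<rbrakk> \<Longrightarrow>
      a \<diamondop> (b \<otimes>\<^bsub>ext_group q e True False\<^esub> c) =
      (a \<diamondop> b) \<otimes>\<^bsub>ext_group q e True False\<^esub> inv\<^bsub>ext_group q e True False\<^esub> a
        \<otimes>\<^bsub>ext_group q e True False\<^esub> (a \<diamondop> c)"
begin

abbreviation "A \<equiv> ext_group q e True False"
abbreviation "C \<equiv> ext_carrier q"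

lemma q2: "q > 2"
  using prime_ge_2_nat[OF prime] mod4 by (cases "q = 2") (auto simp: cong_def)

lemma odd_q: "odd q"
  using q2 prime prime_odd_nat by blast

lemma in_C: "(x, u, v) \<in> C \<longleftrightarrow> 0 \<le> x \<and> x < int q"
  by (rule ext_group_simps(4))

lemma mod_in_C [simp]: "(x mod int q, u, v) \<in> C"
  using q2 by (simp add: in_C)

lemma carrier_A [simp]: "carrier A = C"
  by (rule ext_group_simps(1))

sublocale A: group A
  using q2 by (intro group_ext_group) auto

lemma inv_mult_in_C [simp]:
  "a \<in> C \<Longrightarrow> inv\<^bsub>A\<^esub> a \<in> C" "a \<in> C \<Longrightarrow> b \<in> C \<Longrightarrow> a \<otimes>\<^bsub>A\<^esub> b \<in> C"
  using A.inv_closed A.m_closed by auto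

text \<open>The lambda map -a + a o b, the action of the multiplicative group on the additive
  one.\<close>

definition lam where
  "lam a b = inv\<^bsub>A\<^esub> a \<otimes>\<^bsub>A\<^esub> (a \<diamondop> b)"

lemma lam_closed: "a \<in> C \<Longrightarrow> b \<in> C \<Longrightarrow> lam a b \<in> C"
  unfolding lam_def using closed by simp

lemma op_eq_lam: "a \<in> C \<Longrightarrow> b \<in> C \<Longrightarrow> a \<diamondop> b = a \<otimes>\<^bsub>A\<^esub> lam a b"
  unfolding lam_def using closed by (simp add: A.m_assoc[symmetric])

lemma lam_add:
  assumes "a \<in> C" "b \<in> C" "c \<in> C"
  shows "lam a (b \<otimes>\<^bsub>A\<^esub> c) = lam a b \<otimes>\<^bsub>A\<^esub> lam a c"
  using assms closed by (simp add: lam_def law A.m_assoc)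

text \<open>Expand a o (b o c) with b o c = b + \<open>lam b c\<close> and the brace law, compare
  with (a o b) o c, and cancel a o b.\<close>

lemma lam_op:
  assumes "a \<in> C" "b \<in> C" "c \<in> C"
  shows "lam (a \<diamondop> b) c = lam a (lam b c)"
proof -
  have "a \<diamondop> (b \<diamondop> c) = a \<diamondop> b \<otimes>\<^bsub>A\<^esub> inv\<^bsub>A\<^esub> a \<otimes>\<^bsub>A\<^esub> (a \<diamondop> lam b c)"
    using assms by (simp add: op_eq_lam[of b c] law lam_closed)
  also have "\<dots> = a \<diamondop> b \<otimes>\<^bsub>A\<^esub> lam a (lam b c)"
    using assms closed lam_closed by (simp add: lam_def A.m_assoc)
  finally have "a \<diamondop> b \<otimes>\<^bsub>A\<^esub> lam (a \<diamondop> b) c = a \<diamondop> b \<otimes>\<^bsub>A\<^esub> lam a (lam b c)"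
    using assms closed by (simp add: op_eq_lam[of "a \<diamondop> b" c, symmetric] assoc)
  then show ?thesis
    using assms closed lam_closed by simp
qed

lemma lam_hom: "a \<in> C \<Longrightarrow> lam a \<in> hom A A"
  by (auto simp: hom_def lam_closed lam_add)

lemma lam_inj:
  assumes "a \<in> C"
  shows "inj_on (lam a) C"
proof (rule inj_onI)
  fix b c assume "b \<in> C" "c \<in> C" "lam a b = lam a c"
  then have "a \<diamondop> b = a \<diamondop> c"
    using assms closed by (simp add: lam_def)
  then show "b = c"
    using cancel[OF assms \<open>b \<in> C\<close> \<open>c \<in> C\<close>] by simp
qed

text \<open>The parameters $m$, $t$, $w$ of the automorphism \<open>lam a\<close>.\<close>

definition mu where "mu a = fst (lam a (1, False, False))"
definition tau where "tau a = fst (lam a (0, True, False))"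
definition om where "om a = snd (snd (lam a (0, True, False)))"

lemma lam_form:
  assumes "a \<in> C"
  shows "0 < mu a" "mu a < int q" "0 \<le> tau a" "tau a < int q"
    "0 \<le> x \<Longrightarrow> x < int q \<Longrightarrow>
      lam a (x, u, v) = ((mu a * x + (if u then tau a else 0)) mod int q, u, v \<noteq> (om a \<and> u))"
proof -
  obtain m t w where *: "0 < m" "m < int q" "0 \<le> t" "t < int q"
    and lam: "\<And>x u v. 0 \<le> x \<Longrightarrow> x < int q \<Longrightarrow>
      lam a (x, u, v) = ((m * x + (if u then t else 0)) mod int q, u, v \<noteq> (w \<and> u))"
    using ext_automorphism_form[OF prime odd_q lam_hom[OF assms] lam_inj[OF assms]] by metis
  have "mu a = m" "tau a = t" "om a = w"
    unfolding mu_def tau_def om_def using * q2 by (simp_all add: lam)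
  then show "0 < mu a" "mu a < int q" "0 \<le> tau a" "tau a < int q"
    "0 \<le> x \<Longrightarrow> x < int q \<Longrightarrow>
      lam a (x, u, v) = ((mu a * x + (if u then tau a else 0)) mod int q, u, v \<noteq> (om a \<and> u))"
    using * lam by auto
qed

lemma op_form_mu:
  assumes "(x, u, v) \<in> C" "(x', u', v') \<in> C"
  shows "(x, u, v) \<diamondop> (x', u', v') =
    ((x + sg u * (mu (x, u, v) * x' + (if u' then tau (x, u, v) else 0))) mod int q,
     u \<noteq> u', ((v \<noteq> v') \<noteq> (om (x, u, v) \<and> u')) \<noteq> (e \<and> u \<and> u'))"
  using assms(2) unfolding op_eq_lam[OF assms]
  by (auto simp: lam_form(5)[OF assms(1)] in_C ext_group_simps(3) mod_lin)

text \<open>This and the next two lemmas are \<open>lam_op\<close> in coordinates: composing the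
  maps x -> m x + t makes \<open>mu\<close> multiplicative and \<open>tau\<close> a crossed
  homomorphism.\<close>

lemma mu_op: "a \<in> C \<Longrightarrow> b \<in> C \<Longrightarrow> mu (a \<diamondop> b) = (mu a * mu b) mod int q"
  unfolding mu_def[of "a \<diamondop> b"] using q2
  by (simp add: lam_op in_C lam_form mod_mult_right_eq)

lemma tau_op: "a \<in> C \<Longrightarrow> b \<in> C \<Longrightarrow> [tau (a \<diamondop> b) = mu a * tau b + tau a] (mod int q)"
  unfolding tau_def[of "a \<diamondop> b"] using q2
  by (simp add: lam_op in_C lam_form cong_def)

lemma om_op: "a \<in> C \<Longrightarrow> b \<in> C \<Longrightarrow> om (a \<diamondop> b) = (om a \<noteq> om b)"
  unfolding om_def[of "a \<diamondop> b"] using q2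
  by (auto simp: lam_op in_C lam_form)

lemma coprime_mu: "a \<in> C \<Longrightarrow> coprime (mu a) (int q)"
  using lam_form(1,2)[of a] prime
  by (metis coprime_commute prime_imp_coprime prime_nat_int_transfer zdvd_not_zless)

text \<open>If \<open>mu a\<close> were not 1, the affine map z -> x + \<open>mu a\<close> z would
  have a fixed point b. Applying the multiplicative \<open>mu\<close> to a o b = b and cancelling
  the unit \<open>mu b\<close> gives a contradiction.\<close>

lemma mu_P:
  assumes x: "0 \<le> x" "x < int q"
  shows "mu (x, False, False) = 1"
proof -
  let ?a = "(x, False, False)"
  have a: "?a \<in> C"
    using x by (simp add: in_C)
  have "[mu ?a = 1] (mod int q)"
  proof (rule ccontr)
    assume "\<not> [mu ?a = 1] (mod int q)"
    then have "\<not> int q dvd 1 - mu ?a"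
      by (simp add: cong_iff_dvd_diff dvd_diff_commute)
    then have "coprime (1 - mu ?a) (int q)"
      using prime by (metis coprime_commute prime_imp_coprime prime_nat_int_transfer)
    then obtain c where c: "[(1 - mu ?a) * c = 1] (mod int q)"
      using cong_solve_coprime_int by blast
    \<comment> \<open>\<open>b\<close> is the fixed point of left multiplication by \<open>(x, False, False)\<close> on the Sylow \<open>q\<close>-subgroup\<close>
    let ?b = "((c * x) mod int q, False, False)"
    have "[(1 - mu ?a) * c * x = 1 * x] (mod int q)"
      using c by (rule cong_mult) simp
    then have "[x + mu ?a * (c * x) = c * x] (mod int q)"
      by (simp add: cong_iff_dvd_diff algebra_simps dvd_diff_commute)
    then have "?a \<diamondop> ?b = ?b"
      by (simp add: op_form_mu[OF a] mod_lin cong_def)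
    then have "mu ?b = (mu ?a * mu ?b) mod int q"
      using mu_op[OF a, of ?b] by simp
    then have "[1 * mu ?b = mu ?a * mu ?b] (mod int q)"
      by (metis cong_mod_left cong_refl mult_1)
    then show False
      using \<open>\<not> [mu ?a = 1] (mod int q)\<close> coprime_mu[of ?b]
      by (metis cong_mult_rcancel cong_sym mod_in_C)
  qed
  then show ?thesis
    using lam_form(1,2)[OF a] q2 by (simp add: cong_def)
qed

text \<open>The sign of \<open>mu\<close> as a bit; \<open>mu_cong_sg\<close> shows that only 1 and
  -1 occur as values.\<close>

definition neg where "neg a \<longleftrightarrow> mu a \<noteq> 1"

lemma mu_cong_sg:
  assumes a: "a \<in> C"
  shows "[mu a = sg (neg a)] (mod int q)"
proof -
  obtain x u v where xuv: "a = (x, u, v)"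
    by (metis prod_cases3)
  \<comment> \<open>Squaring clears \<open>u\<close>; squaring again clears \<open>v\<close>,
    because both corrections to \<open>v\<close> contain \<open>u'\<close>.\<close>
  obtain y w where y: "a \<diamondop> a = (y, False, w)"
    using a unfolding xuv by (simp add: op_form_mu)
  then have yC: "(y, False, w) \<in> C"
    using closed[OF a a] by simp
  obtain z where z: "(a \<diamondop> a) \<diamondop> (a \<diamondop> a) = (z, False, False)"
    using yC unfolding y by (simp add: op_form_mu)
  then have zC: "(z, False, False) \<in> C"
    using closed[OF closed[OF a a] closed[OF a a]] by simp
  have "mu ((a \<diamondop> a) \<diamondop> (a \<diamondop> a)) = 1"
    unfolding z using zC by (intro mu_P) (auto simp: in_C)
  then have "[mu a ^ 4 = 1] (mod int q)"
    using a closed q2 by (simp add: mu_op cong_def mod_simps power4_eq_xxxx mult.assoc)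
  then consider "[mu a = 1] (mod int q)" | "[mu a = - 1] (mod int q)"
    using cong_pow4_eq_1[OF prime mod4] by blast
  then show ?thesis
  proof cases
    case 1
    then show ?thesis
      using lam_form(1,2)[OF a] q2 by (simp add: neg_def cong_def)
  next
    case 2
    then have "mu a \<noteq> 1"
      using q2 sg_cong_iff[of q False True] by auto
    then show ?thesis
      using 2 by (simp add: neg_def)
  qed
qed

lemma neg_op: "a \<in> C \<Longrightarrow> b \<in> C \<Longrightarrow> neg (a \<diamondop> b) = (neg a \<noteq> neg b)"
proof -
  assume ab: "a \<in> C" "b \<in> C"
  have "[sg (neg (a \<diamondop> b)) = mu (a \<diamondop> b)] (mod int q)"
    using ab by (intro cong_sym[OF mu_cong_sg] closed)
  also have "[mu (a \<diamondop> b) = mu a * mu b] (mod int q)"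
    using ab by (simp add: mu_op cong_def)
  also have "[mu a * mu b = sg (neg a) * sg (neg b)] (mod int q)"
    using ab by (intro cong_mult mu_cong_sg)
  also have "sg (neg a) * sg (neg b) = sg (neg a \<noteq> neg b)"
    by (simp only: sg_xor)
  finally show "neg (a \<diamondop> b) = (neg a \<noteq> neg b)"
    using sg_cong_iff[OF q2] by blast
qed

lemma tau_op_sg:
  assumes "a \<in> C" "b \<in> C"
  shows "[tau (a \<diamondop> b) = sg (neg a) * tau b + tau a] (mod int q)"
proof -
  have "[mu a * tau b + tau a = sg (neg a) * tau b + tau a] (mod int q)"
    using assms by (intro cong_add cong_mult mu_cong_sg) auto
  with tau_op[OF assms] show ?thesis
    by (rule cong_trans)
qed

lemma op_form:
  assumes "(x, u, v) \<in> C" "(x', u', v') \<in> C"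
  shows "(x, u, v) \<diamondop> (x', u', v') =
    ((x + sg u * (sg (neg (x, u, v)) * x' + (if u' then tau (x, u, v) else 0))) mod int q,
     u \<noteq> u', ((v \<noteq> v') \<noteq> (om (x, u, v) \<and> u')) \<noteq> (e \<and> u \<and> u'))"
proof -
  have "[x + sg u * (mu (x, u, v) * x' + t) = x + sg u * (sg (neg (x, u, v)) * x' + t)] (mod int q)" for t
    using assms(1) by (intro cong_add cong_mult mu_cong_sg) auto
  then show ?thesis
    unfolding op_form_mu[OF assms] by (simp add: cong_def)
qed

lemma neg_P: "0 \<le> x \<Longrightarrow> x < int q \<Longrightarrow> \<not> neg (x, False, False)"
  by (simp add: neg_def mu_P)

text \<open>On Z_q the multiplication is addition, so halving modulo q writes the element as a
  square, and a homomorphism into bits kills squares.\<close>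

lemma om_P:
  assumes x: "0 \<le> x" "x < int q"
  shows "\<not> om (x, False, False)"
proof -
  have "coprime 2 (int q)"
    using odd_q by (simp add: coprime_left_2_iff_odd)
  then obtain c where c: "[2 * c = 1] (mod int q)"
    using cong_solve_coprime_int by blast
  let ?b = "((c * x) mod int q, False, False)"
  have "[2 * c * x = 1 * x] (mod int q)"
    using c by (rule cong_mult) simp
  then have "?b \<diamondop> ?b = (x, False, False)"
    using x by (simp add: op_form neg_P q2 mod_simps cong_def mult.assoc)
  then have "om (x, False, False) = (om ?b \<noteq> om ?b)"
    by (metis om_op mod_in_C)
  then show ?thesis by simp
qed

text \<open>The left cosets of Z_q under the multiplication are the sets with fixed bits. This
  reduces \<open>neg\<close>, \<open>om\<close> and \<open>tau\<close> to their values at x = 0 and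
  on Z_q.\<close>

lemma decompose:
  assumes a: "(x, u, v) \<in> C"
  defines "y \<equiv> (sg u * sg (neg (0, u, v)) * x) mod int q"
  shows "(0, u, v) \<diamondop> (y, False, False) = (x, u, v)"
proof -
  have "(0, u, v) \<in> C"
    using q2 by (simp add: in_C)
  moreover have "(sg u * (sg (neg (0, u, v)) * y)) mod int q = x"
  proof -
    have "(sg u * (sg (neg (0, u, v)) * y)) mod int q =
        (sg u * sg (neg (0, u, v)) * (sg u * sg (neg (0, u, v)) * x)) mod int q"
      unfolding y_def by (metis mod_mult_right_eq mult.assoc)
    also have "sg u * sg (neg (0, u, v)) * (sg u * sg (neg (0, u, v)) * x) = x"
      by (cases u; cases "neg (0, u, v)") simp_all
    finally show ?thesis
      using a by (simp add: in_C)
  qed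
  ultimately show ?thesis
    by (simp add: op_form y_def)
qed

lemma neg_om_coset:
  assumes a: "(x, u, v) \<in> C"
  shows "neg (x, u, v) = neg (0, u, v)" "om (x, u, v) = om (0, u, v)"
proof -
  let ?y = "(sg u * sg (neg (0, u, v)) * x) mod int q"
  have k: "(0, u, v) \<in> C"
    using q2 by (simp add: in_C)
  have "neg (x, u, v) = (neg (0, u, v) \<noteq> neg (?y, False, False))"
    using neg_op[OF k mod_in_C] decompose[OF a] by metis
  then show "neg (x, u, v) = neg (0, u, v)"
    using q2 by (simp add: neg_P)
  have "om (x, u, v) = (om (0, u, v) \<noteq> om (?y, False, False))"
    using om_op[OF k mod_in_C] decompose[OF a] by metis
  then show "om (x, u, v) = om (0, u, v)"
    using q2 by (simp add: om_P)
qed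

section \<open>The crossed homomorphism \<open>tau\<close>\<close>

definition tau1 where "tau1 = tau (1, False, False)"

text \<open>Since \<open>mu\<close> is 1 on Z_q, the crossed homomorphism is additive there.\<close>

lemma tau_P: "[tau (int n mod int q, False, False) = tau1 * int n] (mod int q)"
proof (induction n)
  case 0
  have o: "(0, False, False) \<in> C"
    using q2 by (simp add: in_C)
  then have "(0, False, False) \<diamondop> (0, False, False) = (0, False, False)"
    by (simp add: op_form om_P q2)
  then have "[0 + tau (0, False, False) = tau (0, False, False) + tau (0, False, False)] (mod int q)"
    using tau_op_sg[OF o o] q2 by (simp add: neg_P)
  then show ?case
    by (simp only: cong_add_rcancel cong_sym_eq[of 0]) simp
next
  case (Suc n)
  have one: "(1, False, False) \<in> C"
    using q2 by (simp add: in_C)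
  have eq: "(int n mod int q, False, False) \<diamondop> (1, False, False) = (int (Suc n) mod int q, False, False)"
    using q2 by (simp add: op_form[OF mod_in_C one] neg_P om_P mod_simps add.commute)
  have "[tau (int (Suc n) mod int q, False, False) = tau1 + tau (int n mod int q, False, False)] (mod int q)"
    using tau_op_sg[OF mod_in_C one, of "int n" False False] q2
    by (simp add: eq neg_P tau1_def)
  also have "[tau1 + tau (int n mod int q, False, False) = tau1 + tau1 * int n] (mod int q)"
    by (intro cong_add Suc.IH) simp
  finally show ?case
    by (simp add: algebra_simps)
qed

text \<open>Apply the crossed homomorphism law to \<open>decompose\<close>: the sign of (0,u,v)
  occurs once in the law and once in \<open>?y\<close>, and cancels.\<close>

lemma tau_coset:
  assumes a: "(x, u, v) \<in> C"
  shows "[tau (x, u, v) = tau (0, u, v) + sg u * (tau1 * x)] (mod int q)"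
proof -
  let ?s = "sg (neg (0, u, v))"
  let ?y = "(sg u * ?s * x) mod int q"
  have k: "(0, u, v) \<in> C"
    using q2 by (simp add: in_C)
  have "[tau (x, u, v) = ?s * tau (?y, False, False) + tau (0, u, v)] (mod int q)"
    using tau_op_sg[OF k mod_in_C] decompose[OF a] by metis
  also have "[?s * tau (?y, False, False) + tau (0, u, v) =
      ?s * (tau1 * (sg u * ?s * x)) + tau (0, u, v)] (mod int q)"
  proof (intro cong_add cong_mult)
    have "[tau (?y, False, False) = tau1 * ?y] (mod int q)"
      using tau_P[of "nat ?y"] q2 by simp
    also have "[tau1 * ?y = tau1 * (sg u * ?s * x)] (mod int q)"
      by (intro cong_mult) simp_all
    finally show "[tau (?y, False, False) = tau1 * (sg u * ?s * x)] (mod int q)" .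
  qed simp_all
  also have "?s * (tau1 * (sg u * ?s * x)) = sg u * (tau1 * x)"
    by (cases "neg (0, u, v)") simp_all
  finally show ?thesis
    by (simp add: add.commute)
qed

abbreviation "zz \<equiv> (0 :: int, False, True)"
abbreviation "gg \<equiv> (0 :: int, True, False)"

lemma zz_gg: "zz \<in> C" "gg \<in> C" "(0, u, v) \<in> C"
  using q2 by (simp_all add: in_C)

text \<open>The product (1,0,0) o \<open>gg\<close> = (1 + \<open>tau1\<close>, 1, 0) is evaluated
  under \<open>tau\<close> in two ways: the crossed homomorphism law gives
  \<open>tau gg + tau1\<close>, and \<open>tau_coset\<close> gives
  \<open>tau gg - tau1 * (1 + tau1)\<close>.\<close>

lemma tau1_cases: "\<exists>d. [tau1 = sg d - 1] (mod int q)"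
proof -
  have one: "(1, False, False) \<in> C"
    using q2 by (simp add: in_C)
  have eq: "(1, False, False) \<diamondop> gg = ((1 + tau1) mod int q, True, False)"
    using q2 by (simp add: op_form[OF one zz_gg(2)] neg_P om_P tau1_def)
  have "[tau gg + tau1 = tau ((1 + tau1) mod int q, True, False)] (mod int q)"
    using tau_op_sg[OF one zz_gg(2)] q2 unfolding eq
    by (simp add: neg_P tau1_def cong_sym)
  also have "[tau ((1 + tau1) mod int q, True, False) =
      tau gg + sg True * (tau1 * ((1 + tau1) mod int q))] (mod int q)"
    by (rule tau_coset) simp
  also have "[tau gg + sg True * (tau1 * ((1 + tau1) mod int q)) =
      tau gg + sg True * (tau1 * (1 + tau1))] (mod int q)"
    by (intro cong_add cong_mult) simp_all
  finally have "int q dvd tau1 * (tau1 + 2)"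
    by (simp add: cong_iff_dvd_diff algebra_simps)
  then consider "int q dvd tau1" | "int q dvd tau1 + 2"
    using prime by (auto simp: prime_dvd_mult_iff)
  then show ?thesis
  proof cases
    case 1
    then have "[tau1 = sg False - 1] (mod int q)" by (simp add: cong_iff_dvd_diff)
    then show ?thesis by blast
  next
    case 2
    then have "[tau1 = sg True - 1] (mod int q)" by (simp add: cong_iff_dvd_diff)
    then show ?thesis by blast
  qed
qed

lemma gg_op_zz: "gg \<diamondop> zz = (0, True, True)"
  by (simp add: op_form[OF zz_gg(2,1)])

lemma zz_op_gg: "zz \<diamondop> gg = (tau zz mod int q, True, \<not> om zz)"
  by (simp add: op_form[OF zz_gg(1,2)])

text \<open>If \<open>om zz\<close> were set, \<open>zz\<close> o \<open>gg\<close> would have the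
  bits of \<open>gg\<close>, hence the same \<open>om\<close>, whereas multiplicativity makes the
  two differ.\<close>

lemma om_zz: "\<not> om zz"
proof
  assume z: "om zz"
  have "om (zz \<diamondop> gg) = om gg"
    unfolding zz_op_gg using z by (simp add: neg_om_coset)
  then show False
    using z om_op[OF zz_gg(1,2)] by simp
qed

lemma om_eq:
  assumes "(x, u, v) \<in> C"
  shows "om (x, u, v) = (om gg \<and> u)"
proof -
  have "om (0, True, True) = om gg"
    using om_op[OF zz_gg(2,1)] om_zz by (simp add: gg_op_zz)
  moreover have "\<not> om (0, False, False)"
    using q2 by (simp add: om_P)
  ultimately have "om (0, u, v) = (om gg \<and> u)"
    using om_zz by (cases u; cases v) auto
  then show ?thesis
    using neg_om_coset[OF assms] by simp
qed

lemma neg_eq: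
  assumes "(x, u, v) \<in> C"
  shows "neg (x, u, v) = ((neg gg \<and> u) \<noteq> (neg zz \<and> v))"
proof -
  have "neg (0, True, True) = (neg gg \<noteq> neg zz)"
    using neg_op[OF zz_gg(2,1)] by (simp add: gg_op_zz)
  moreover have "\<not> neg (0, False, False)"
    using q2 by (simp add: neg_P)
  ultimately have "neg (0, u, v) = ((neg gg \<and> u) \<noteq> (neg zz \<and> v))"
    by (cases u; cases v) auto
  then show ?thesis
    using neg_om_coset[OF assms] by simp
qed

end

text \<open>Solves for the translation that makes \<open>tau\<close> vanish on the bits; \<open>t\<close> and \<open>t'\<close> are its values
  at \<open>(0, False, True)\<close> and \<open>(0, True, False)\<close>, and the hypotheses are the relations between them.\<close>

lemma shift_exists:
  fixes t t' :: int
  assumes q: "odd q" and fj: "f \<Longrightarrow> \<not> j"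
    and a: "int q dvd (1 + sg j) * t"
    and b: "int q dvd (sg d - sg i) * t - (1 - sg j) * t'"
    and c: "int q dvd (sg i + sg d) * t' - (if f then t else 0)"
  shows "\<exists>s. int q dvd t - (sg j - 1) * s \<and> int q dvd t' - (sg i - sg d) * s"
proof -
  \<comment> \<open>An inverse of 2 modulo q.\<close>
  define h where "h = (int q + 1) div 2"
  have h: "2 * h = int q + 1"
  proof -
    have "odd (int q)"
      using q by simp
    then show ?thesis
      unfolding h_def by presburger
  qed
  show ?thesis
  proof (cases j)
    case False
    then have t: "int q dvd t"
      using a odd_dvd_double[OF q, of t] by simp
    show ?thesis
    proof (cases "i = d")
      case True
      have "int q dvd (sg i + sg d) * t'"
        using dvd_add[OF c, of "if f then t else 0"] t by auto
      then have "int q dvd 2 * t'"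
        using True by (cases d) auto
      then have "int q dvd t'"
        by (rule odd_dvd_double[OF q])
      then show ?thesis
        using t by (intro exI[of _ 0]) simp
    next
      case neq: False
      \<comment> \<open>Here \<open>sg i - sg d\<close> is -2 \<open>sg d\<close>, which determines
        the solution s modulo q.\<close>
      have eq: "(sg i - sg d) * (- sg d * h * t') = (int q + 1) * t'"
        using neq unfolding h[symmetric] by (cases d; cases i) simp_all
      have "int q dvd t' - (sg i - sg d) * (- sg d * h * t')"
        unfolding eq by (simp add: algebra_simps)
      then show ?thesis
        using t False by (intro exI[of _ "- sg d * h * t'"] conjI) simp_all
    qed
  next
    case True
    \<comment> \<open>Now \<open>sg j - 1\<close> is -2, so the first congruence already determines
      s; the second must follow from the relations.\<close>
    have t: "int q dvd t - (sg j - 1) * (- h * t)"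
    proof -
      have eq: "(sg j - 1) * (- h * t) = (int q + 1) * t"
        using True unfolding h[symmetric] by simp
      show ?thesis
        unfolding eq by (simp add: algebra_simps)
    qed
    \<comment> \<open>For \<open>i = d\<close>, relation \<open>c\<close> without its carry term
      gives 2t' = 0; otherwise \<open>b\<close> expresses t' by t.\<close>
    have "int q dvd t' - (sg i - sg d) * (- h * t)"
    proof (cases "i = d")
      case True
      then have "int q dvd 2 * t'"
        using c fj \<open>j\<close> by (cases f; cases d) auto
      then show ?thesis
        using True odd_dvd_double[OF q, of t'] by simp
    next
      case False
      have "int q dvd 2 * (sg d * t - t')"
        using b False \<open>j\<close> by (cases d; cases i) (simp_all add: algebra_simps)
      then have "int q dvd sg d * t - t'"
        by (rule odd_dvd_double[OF q])
      then have "int q dvd - (sg d * t - t') - int q * (sg d * t)"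
        by (intro dvd_diff) (simp_all only: dvd_minus_iff dvd_triv_left)
      moreover have eq: "(sg i - sg d) * (- h * t) = sg d * (int q + 1) * t"
        using False unfolding h[symmetric] by (cases d; cases i) simp_all
      ultimately show ?thesis
        unfolding eq by (simp add: algebra_simps)
    qed
    with t show ?thesis by blast
  qed
qed

text \<open>Conjugation by an element of $\mathbb{Z}_q$, since $t = 2s$ is solvable modulo an odd \<open>q\<close>.\<close>

definition shift :: "nat \<Rightarrow> int \<Rightarrow> int \<times> bool \<times> bool \<Rightarrow> int \<times> bool \<times> bool" where
  "shift q s = (\<lambda>(x, u, v). ((x + (if u then s else 0)) mod int q, u, v))"

lemma shift_iso:
  assumes "q > 0"
  shows "shift q s \<in> iso (ext_group q e True False) (ext_group q e True False)" (is "_ \<in> iso ?A ?A")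
proof (rule iso_of_bij)
  show "bij_betw (shift q s) (carrier ?A) (carrier ?A)"
    using assms
    by (intro bij_betw_byWitness[where f' = "shift q (- s)"])
      (auto simp: ext_group_simps(1) ext_carrier_def shift_def mod_simps)
  show "shift q s (a \<otimes>\<^bsub>?A\<^esub> b) = shift q s a \<otimes>\<^bsub>?A\<^esub> shift q s b" for a b
  proof -
    obtain x u v x' u' v' where *: "a = (x, u, v)" "b = (x', u', v')"
      by (metis prod_cases3)
    show ?thesis
      unfolding * shift_def prod.case ext_group_simps mod_lin mod_add_left_eq
      by (cases u; cases u') (simp_all add: algebra_simps)
  qed
qed

context ext_brace
begin

lemma tau_zero: "[tau (0, False, False) = 0] (mod int q)"
  using tau_P[of 0] by simp

text \<open>A change of coordinates by \<open>shift q s\<close> alters \<open>tau\<close> by known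
  terms. The relations that make a suitable s exist come from evaluating \<open>tau\<close> at
  \<open>zz\<close> o \<open>zz\<close>, \<open>zz\<close> o \<open>gg\<close> and \<open>gg\<close>
  o \<open>gg\<close>.\<close>

lemma op_normal_form:
  "\<exists>f i j d s. (j \<longrightarrow> \<not> f) \<and> (\<forall>a\<in>C. \<forall>b\<in>C.
     shift q s (a \<diamondop> b) = shift q s a \<otimes>\<^bsub>model q e f i j d\<^esub> shift q s b)"
proof -
  \<comment> \<open>One carry comes from the addition, the other from \<open>lam gg\<close> acting
    on the bit \<open>v\<close>.\<close>
  define f where "f = (e \<noteq> om gg)"
  define i where "i = neg gg"
  define j where "j = neg zz"
  obtain d where d: "[tau1 = sg d - 1] (mod int q)"
    using tau1_cases by blast
  have zz_zz: "zz \<diamondop> zz = (0, False, False)"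
    by (simp add: op_form[OF zz_gg(1,1)])
  have gg_gg: "gg \<diamondop> gg = ((- tau gg) mod int q, False, f)"
    by (auto simp: op_form[OF zz_gg(2,2)] f_def)
  \<comment> \<open>With a carry, \<open>gg\<close> o \<open>gg\<close> lies in the coset of
    \<open>zz\<close>, while \<open>neg\<close> vanishes on every square.\<close>
  have fj: "\<not> j" if f
    using neg_op[OF zz_gg(2,2)] that unfolding gg_gg
    by (simp add: neg_eq j_def)
  have tau_form: "[tau (x, u, v) = tau (0, u, v) + sg u * ((sg d - 1) * x)] (mod int q)"
    if "(x, u, v) \<in> C" for x u v
  proof -
    have "[tau (0, u, v) + sg u * (tau1 * x) = tau (0, u, v) + sg u * ((sg d - 1) * x)] (mod int q)"
      using d by (intro cong_add cong_mult) auto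
    with tau_coset[OF that] show ?thesis
      by (rule cong_trans)
  qed
  have a: "int q dvd (1 + sg j) * tau zz"
  proof -
    have "[sg j * tau zz + tau zz = 0] (mod int q)"
      using tau_op_sg[OF zz_gg(1,1)] tau_zero unfolding zz_zz j_def
      by (blast intro: cong_trans cong_sym)
    then show ?thesis
      by (simp add: cong_iff_dvd_diff algebra_simps)
  qed
  have tau_gz: "[tau (0, True, True) = sg i * tau zz + tau gg] (mod int q)"
    using tau_op_sg[OF zz_gg(2,1)] by (simp add: gg_op_zz i_def)
  \<comment> \<open>Both \<open>zz\<close> o \<open>gg\<close> and \<open>gg\<close> o
    \<open>zz\<close> have the bits (1,1), so \<open>tau_form\<close> links the values of
    \<open>tau\<close> at them.\<close>
  have "zz \<diamondop> gg = (tau zz, True, True)"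
    using om_zz lam_form(3,4)[OF zz_gg(1)] by (simp add: zz_op_gg)
  then have "[tau (tau zz, True, True) = sg j * tau gg + tau zz] (mod int q)"
    using tau_op_sg[OF zz_gg(1,2)] by (simp add: j_def)
  moreover have "[tau (tau zz, True, True) = tau (0, True, True) + sg True * ((sg d - 1) * tau zz)] (mod int q)"
    using lam_form(3,4)[OF zz_gg(1)] by (intro tau_form) (simp add: in_C)
  moreover have "[tau (0, True, True) + sg True * ((sg d - 1) * tau zz) =
      (sg i * tau zz + tau gg) + sg True * ((sg d - 1) * tau zz)] (mod int q)"
    using tau_gz by (intro cong_add) auto
  ultimately have "[sg j * tau gg + tau zz =
      (sg i * tau zz + tau gg) + sg True * ((sg d - 1) * tau zz)] (mod int q)"
    by (meson cong_sym cong_trans)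
  then have b: "int q dvd (sg d - sg i) * tau zz - (1 - sg j) * tau gg"
    by (simp add: cong_iff_dvd_diff algebra_simps)
  have "[tau (gg \<diamondop> gg) = sg i * tau gg + tau gg] (mod int q)"
    using tau_op_sg[OF zz_gg(2,2)] by (simp add: i_def)
  moreover have "[tau (gg \<diamondop> gg) = tau (0, False, f) + sg False * ((sg d - 1) * ((- tau gg) mod int q))] (mod int q)"
    unfolding gg_gg by (intro tau_form) simp
  moreover have "[tau (0, False, f) + sg False * ((sg d - 1) * ((- tau gg) mod int q)) =
      (if f then tau zz else 0) + sg False * ((sg d - 1) * - tau gg)] (mod int q)"
    using tau_zero by (intro cong_add cong_mult) auto
  ultimately have "[sg i * tau gg + tau gg = (if f then tau zz else 0) + sg False * ((sg d - 1) * - tau gg)] (mod int q)"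
    by (meson cong_sym cong_trans)
  then have c: "int q dvd (sg i + sg d) * tau gg - (if f then tau zz else 0)"
    by (simp add: cong_iff_dvd_diff algebra_simps split: if_splits)
  obtain s where "int q dvd tau zz - (sg j - 1) * s" "int q dvd tau gg - (sg i - sg d) * s"
    using shift_exists[OF odd_q fj a b c] by blast
  then have s: "[tau zz = (sg j - 1) * s] (mod int q)" "[tau gg = (sg i - sg d) * s] (mod int q)"
    by (simp_all add: cong_iff_dvd_diff)
  have "[sg i * tau zz + tau gg = sg i * ((sg j - 1) * s) + (sg i - sg d) * s] (mod int q)"
    using s by (intro cong_add cong_mult) auto
  with tau_gz have s': "[tau (0, True, True) = sg i * ((sg j - 1) * s) + (sg i - sg d) * s] (mod int q)"
    by (rule cong_trans)
  \<comment> \<open>The right side is \<open>tau\<close> at x = 0 for the model pulled back along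
    \<open>shift q s\<close>: conjugating by the shift contributes (m - 1)s, and the shifted point
    of the model contributes the last term.\<close>
  have tau0: "[tau (0, u, v) = (sg ((i \<and> u) \<noteq> (j \<and> v)) - 1) * s - (if u then (sg d - 1) * s else 0)] (mod int q)"
    for u v
  proof -
    have "sg i * ((sg j - 1) * s) + (sg i - sg d) * s = (sg (i \<noteq> j) - 1) * s - (sg d - 1) * s"
      by (simp only: sg_xor) (simp add: algebra_simps)
    with s' have "[tau (0, True, True) = (sg (i \<noteq> j) - 1) * s - (sg d - 1) * s] (mod int q)"
      by simp
    moreover have "(sg i - sg d) * s = (sg i - 1) * s - (sg d - 1) * s"
      by (simp add: left_diff_distrib)
    with s(2) have "[tau (0, True, False) = (sg i - 1) * s - (sg d - 1) * s] (mod int q)"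
      by simp
    ultimately show ?thesis
      using s(1) tau_zero by (cases u; cases v) simp_all
  qed
  have "shift q s (a \<diamondop> b) = shift q s a \<otimes>\<^bsub>model q e f i j d\<^esub> shift q s b" if ab: "a \<in> C" "b \<in> C" for a b
  proof -
    obtain x u v x' u' v' where xuv: "a = (x, u, v)" "b = (x', u', v')"
      by (metis prod_cases3)
    let ?n = "(i \<and> u) \<noteq> (j \<and> v)"
    define t where "t = (sg ?n - 1) * s - (if u then (sg d - 1) * s else 0) + sg u * ((sg d - 1) * x)"
    have "(x, u, v) \<in> C"
      using ab xuv by simp
    then have "[tau (x, u, v) = t] (mod int q)"
      unfolding t_def by (rule cong_trans[OF tau_form cong_add[OF tau0 cong_refl]])
    then have "[x + sg u * (sg ?n * x' + (if u' then tau (x, u, v) else 0)) + (if u \<noteq> u' then s else 0) =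
      x + sg u * (sg ?n * x' + (if u' then t else 0)) + (if u \<noteq> u' then s else 0)] (mod int q)"
      by (intro cong_add cong_mult) auto
    also have "x + sg u * (sg ?n * x' + (if u' then t else 0)) + (if u \<noteq> u' then s else 0) =
        sg (d \<and> u') * (x + (if u then s else 0)) + sg (u \<noteq> ?n) * (x' + (if u' then s else 0))"
      unfolding t_def sg_xor
      by (cases u; cases u') (simp_all add: algebra_simps)
    finally have "(x + sg u * (sg ?n * x' + (if u' then tau (x, u, v) else 0)) + (if u \<noteq> u' then s else 0)) mod int q =
        (sg (d \<and> u') * (x + (if u then s else 0)) + sg (u \<noteq> ?n) * (x' + (if u' then s else 0))) mod int q"
      by (simp only: cong_def)
    moreover have "neg (x, u, v) = ?n" "om (x, u, v) = (om gg \<and> u)"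
      using ab xuv by (simp_all add: neg_eq om_eq i_def j_def)
    ultimately show ?thesis
      using ab unfolding xuv
      by (simp only: op_form shift_def prod.case model_simps mod_lin mod_add_left_eq)
        (auto simp: f_def)
  qed
  then show ?thesis
    using fj by blast
qed

end

text \<open>Replacing v by v + u turns the character u + v into v. Carries depend on
  \<open>u\<close> alone and the additive sign ignores \<open>v\<close>, so both operations are
  respected.\<close>

lemma model_reduce:
  assumes "q > 0"
  shows "brace_isomorphic (model q e False True True d) (model q e False False True d)"
    (is "brace_isomorphic ?M ?N")
proof -
  let ?h = "\<lambda>(x, u, v). (x, u, v \<noteq> u) :: int \<times> bool \<times> bool"
  have bij: "bij_betw ?h (ext_carrier q) (ext_carrier q)"
    by (intro bij_betw_byWitness[where f' = ?h]) (auto simp: ext_carrier_def)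
  have "?h \<in> iso (add_monoid ?M) (add_monoid ?N)" unfolding model_simps(4)
  proof (rule iso_of_bij)
    show "?h (a \<otimes>\<^bsub>ext_group q e True False\<^esub> b) =
        ?h a \<otimes>\<^bsub>ext_group q e True False\<^esub> ?h b" for a b
      by (cases a; cases b) (auto simp: ext_group_simps)
  qed (use bij in \<open>simp add: ext_group_simps\<close>)
  moreover have "?h \<in> iso ?M ?N"
  proof (rule iso_of_bij)
    show "?h (a \<otimes>\<^bsub>?M\<^esub> b) = ?h a \<otimes>\<^bsub>?N\<^esub> ?h b" for a b
    proof -
      obtain x u v x' u' v' where *: "a = (x, u, v)" "b = (x', u', v')"
        by (metis prod_cases3)
      show ?thesis
        unfolding * model_simps prod.case by (cases u; cases v; auto simp: model_simps)
    qed
  qed (use bij in \<open>simp add: model_simps\<close>)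
  ultimately show ?thesis
    by (auto simp: brace_isomorphic_def brace_iso_def)
qed

lemma brace_isomorphic_trans:
  assumes "brace_isomorphic B C" "brace_isomorphic C D"
  shows "brace_isomorphic B D"
proof -
  obtain g h where "g \<in> brace_iso B C" "h \<in> brace_iso C D"
    using assms by (auto simp: brace_isomorphic_def)
  then have "h \<circ> g \<in> brace_iso B D"
    unfolding brace_iso_def by (auto intro: iso_set_trans)
  then show ?thesis
    by (auto simp: brace_isomorphic_def)
qed

lemma brace_isomorphic_sym:
  assumes "skew_brace B" "brace_isomorphic B C"
  shows "brace_isomorphic C B"
proof -
  obtain h where h: "h \<in> iso (add_monoid B) (add_monoid C)" "h \<in> iso B C"
    using assms(2) by (auto simp: brace_isomorphic_def brace_iso_def)
  have "inv_into (carrier B) h \<in> iso C B"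
    using assms(1) h by (intro group.iso_set_sym) (auto simp: skew_brace_def)
  moreover have "inv_into (carrier B) h \<in> iso (add_monoid C) (add_monoid B)"
    using group.iso_set_sym[OF skew_brace.add_group[OF assms(1)] h(1)] by simp
  ultimately show ?thesis
    by (auto simp: brace_isomorphic_def brace_iso_def)
qed

text \<open>The multiplication is transported along an additive isomorphism, so that
  \<open>ext_brace\<close> applies. If both \<open>i\<close> and \<open>j\<close> are set, the model
  has no carry and \<open>model_reduce\<close> clears \<open>i\<close>.\<close>

lemma skew_brace_isomorphic_model:
  assumes q: "prime q" "[q = 3] (mod 4)"
    and B: "skew_brace B" and iso: "add_monoid B \<cong> ext_group q e True False"
  shows "\<exists>f i j d. (j \<longrightarrow> \<not> f \<and> \<not> i) \<and> brace_isomorphic B (model q e f i j d)"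
proof -
  let ?A = "ext_group q e True False"
  have q0: "q > 0"
    using q(1) prime_gt_0_nat by blast
  interpret B: skew_brace B by fact
  interpret AB: group "add_monoid B" by (rule B.add_group)
  interpret A: group ?A
    using q0 by (intro group_ext_group) auto
  obtain h where h: "h \<in> iso (add_monoid B) ?A"
    using iso by (auto simp: is_iso_def)
  interpret h: group_hom "add_monoid B" ?A h
    using h by unfold_locales (simp add: iso_def)
  have bij: "bij_betw h (carrier B) (ext_carrier q)"
    using h by (simp add: iso_def ext_group_simps)
  define g where "g = inv_into (carrier B) h"
  have gh: "g (h a) = a" if "a \<in> carrier B" for a
    using bij that by (simp add: g_def bij_betw_def)
  have hg: "h (g a) = a" "g a \<in> carrier B" if "a \<in> ext_carrier q" for a
    using bij that by (simp_all add: g_def bij_betw_inv_into_right bij_betw_def inv_into_into)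
  have hC: "h a \<in> ext_carrier q" if "a \<in> carrier B" for a
    using bij that by (auto simp: bij_betw_def)
  have hadd: "h (a \<oplus>\<^bsub>B\<^esub> b) = h a \<otimes>\<^bsub>?A\<^esub> h b" if "a \<in> carrier B" "b \<in> carrier B" for a b
    using h.hom_mult[of a b] that by simp
  have hneg: "h (\<ominus>\<^bsub>B\<^esub> a) = inv\<^bsub>?A\<^esub> h a" if "a \<in> carrier B" for a
    using h.hom_inv[of a] that by (simp add: a_inv_def)
  have add_cl: "a \<oplus>\<^bsub>B\<^esub> b \<in> carrier B" if "a \<in> carrier B" "b \<in> carrier B" for a b
    using AB.m_closed[of a b] that by simp
  have neg_cl: "\<ominus>\<^bsub>B\<^esub> a \<in> carrier B" if "a \<in> carrier B" for a
    using AB.inv_closed[of a] that by (simp add: a_inv_def)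
  define op where "op a b = h (g a \<otimes>\<^bsub>B\<^esub> g b)" for a b
  interpret op: ext_brace q e op
  proof
    show "prime q" "[q = 3] (mod 4)" by fact+
    show "op a b \<in> ext_carrier q" if "a \<in> ext_carrier q" "b \<in> ext_carrier q" for a b
      using that by (simp add: op_def hC hg)
    show "op (op a b) c = op a (op b c)"
      if "a \<in> ext_carrier q" "b \<in> ext_carrier q" "c \<in> ext_carrier q" for a b c
      using that by (simp add: op_def gh hg B.m_assoc)
    show "b = c" if *: "a \<in> ext_carrier q" "b \<in> ext_carrier q" "c \<in> ext_carrier q" "op a b = op a c" for a b c
    proof -
      have "g a \<otimes>\<^bsub>B\<^esub> g b = g a \<otimes>\<^bsub>B\<^esub> g c"
        using *(4) gh *(1-3) by (metis B.m_closed hg(2) op_def)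
      then have "g b = g c"
        using * by (simp add: hg)
      then show ?thesis
        using * hg by metis
    qed
    show "op a (b \<otimes>\<^bsub>?A\<^esub> c) = op a b \<otimes>\<^bsub>?A\<^esub> inv\<^bsub>?A\<^esub> a \<otimes>\<^bsub>?A\<^esub> op a c"
      if *: "a \<in> ext_carrier q" "b \<in> ext_carrier q" "c \<in> ext_carrier q" for a b c
    proof -
      have "g (b \<otimes>\<^bsub>?A\<^esub> c) = g b \<oplus>\<^bsub>B\<^esub> g c"
        using * gh[of "g b \<oplus>\<^bsub>B\<^esub> g c"] by (simp add: hadd hg add_cl)
      then show ?thesis
        using * by (simp add: op_def B.brace_law hadd hneg hg add_cl neg_cl)
    qed
  qed
  obtain f i j d s where fj: "j \<longrightarrow> \<not> f" and normal: "\<forall>a\<in>ext_carrier q. \<forall>b\<in>ext_carrier q.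
     shift q s (op a b) = shift q s a \<otimes>\<^bsub>model q e f i j d\<^esub> shift q s b"
    using op.op_normal_form by blast
  let ?M = "model q e f i j d"
  note shift = shift_iso[OF q0, of s e]
  have "shift q s \<circ> h \<in> iso (add_monoid B) (add_monoid ?M)"
    unfolding model_simps(4) using iso_set_trans[OF h shift] .
  moreover have "shift q s \<circ> h \<in> iso B ?M"
  proof (rule iso_of_bij)
    show "bij_betw (shift q s \<circ> h) (carrier B) (carrier ?M)"
      using bij_betw_trans[OF bij, of "shift q s" "ext_carrier q"] shift
      by (simp add: iso_def ext_group_simps model_simps)
    show "(shift q s \<circ> h) (a \<otimes>\<^bsub>B\<^esub> b) = (shift q s \<circ> h) a \<otimes>\<^bsub>?M\<^esub> (shift q s \<circ> h) b"
      if "a \<in> carrier B" "b \<in> carrier B" for a b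
      using normal[rule_format, of "h a" "h b"] that by (simp add: op_def gh hC)
  qed
  ultimately have M: "brace_isomorphic B ?M"
    by (auto simp: brace_isomorphic_def brace_iso_def)
  show ?thesis
  proof (cases "i \<and> j")
    case True
    then have ij: "i = True" "j = True" "f = False"
      using fj by auto
    have "brace_isomorphic B (model q e False False True d)"
      using M unfolding ij by (rule brace_isomorphic_trans) (rule model_reduce[OF q0])
    then show ?thesis by blast
  next
    case False
    then show ?thesis
      using M fj by (intro exI[of _ f] exI[of _ i] exI[of _ j] exI[of _ d] conjI) auto
  qed
qed

section \<open>Counting the models\<close>

text \<open>If \<open>j\<close> is set, there is no carry and both groups are the direct product
  with the dihedral group.\<close>

lemma ext_group_iso_canonical:
  assumes q: "q > 0" and fj: "j \<longrightarrow> \<not> f"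
  shows "ext_group q f i j \<cong> ext_group q f (i \<or> j) False"
proof (cases j)
  case True
  then have "ext_group q f i j \<cong> integer_mod_group 2 \<times>\<times> inversion_semidirect q 2"
    using fj ext_group_iso_Z2Dih[OF q, of i j] by simp
  also have "\<dots> \<cong> ext_group q f (i \<or> j) False"
    using True fj ext_group_iso_Z2Dih[OF q, of True False] q
    by (simp add: group.iso_sym group_ext_group)
  finally show ?thesis .
next
  case False
  then show ?thesis
    using iso_set_refl[of "ext_group q f i False"] by (auto simp: is_iso_def)
qed

lemma ext_group_comm_iff:
  assumes "q > 2"
  shows "(\<forall>a\<in>ext_carrier q. \<forall>b\<in>ext_carrier q.
      a \<otimes>\<^bsub>ext_group q f i j\<^esub> b = b \<otimes>\<^bsub>ext_group q f i j\<^esub> a) \<longleftrightarrow> \<not> (i \<or> j)" (is "?L \<longleftrightarrow> _")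
proof
  assume L: ?L
  have ne: "(- 1) mod int q \<noteq> 1"
    using assms by (simp add: zmod_minus1)
  have "(0, u, v) \<otimes>\<^bsub>ext_group q f i j\<^esub> (1, False, False) =
      (1, False, False) \<otimes>\<^bsub>ext_group q f i j\<^esub> (0, u, v)" for u v
    using L assms by (auto simp: ext_carrier_def)
  from this[of True False] this[of False True] show "\<not> (i \<or> j)"
    using ne assms by (auto simp: ext_group_simps)
next
  assume "\<not> (i \<or> j)"
  then have ij: "i = False" "j = False"
    by auto
  show ?L
    unfolding ij ext_carrier_def by (auto simp: ext_group_simps add.commute)
qed

text \<open>Elements of order 4 detect the carry: without it every square lies in Z_q, which has odd
  order. Products instead of powers make the condition easy to carry through an isomorphism.\<close>

lemma ext_group_order4_iff:
  fixes f i j :: bool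
  assumes "odd q" "j \<longrightarrow> \<not> f"
  defines "G \<equiv> ext_group q f i j"
  shows "(\<exists>a\<in>ext_carrier q. a \<otimes>\<^bsub>G\<^esub> a \<noteq> \<one>\<^bsub>G\<^esub> \<and> (a \<otimes>\<^bsub>G\<^esub> a) \<otimes>\<^bsub>G\<^esub> (a \<otimes>\<^bsub>G\<^esub> a) = \<one>\<^bsub>G\<^esub>) \<longleftrightarrow> f"
    (is "?L \<longleftrightarrow> f")
proof
  assume ?L
  then obtain x u v where x: "(x, u, v) \<otimes>\<^bsub>G\<^esub> (x, u, v) \<noteq> \<one>\<^bsub>G\<^esub>"
    "((x, u, v) \<otimes>\<^bsub>G\<^esub> (x, u, v)) \<otimes>\<^bsub>G\<^esub> ((x, u, v) \<otimes>\<^bsub>G\<^esub> (x, u, v)) = \<one>\<^bsub>G\<^esub>"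
    by auto
  define y where "y = x + sg ((i \<and> u) \<noteq> (j \<and> v)) * x"
  show f
  proof (rule ccontr)
    assume "\<not> f"
    then have "y mod int q \<noteq> 0" "(2 * y) mod int q = 0"
      using x by (simp_all add: G_def ext_group_simps y_def mod_simps)
    then show False
      using odd_dvd_double[OF assms(1), of y] by (simp add: mod_eq_0_iff_dvd)
  qed
next
  assume f
  moreover have "(0, True, False) \<in> ext_carrier q"
    using assms(1) by (cases q) (auto simp: ext_carrier_def)
  ultimately show ?L
    by (intro bexI[of _ "(0, True, False)"]) (simp_all add: G_def ext_group_simps)
qed

lemma ext_group_iso_imp_eq:
  assumes q: "odd q" "q > 2" and fj: "j \<longrightarrow> \<not> f" "j' \<longrightarrow> \<not> f'"
    and iso: "ext_group q f i j \<cong> ext_group q f' i' j'"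
  shows "f = f' \<and> (i \<or> j) = (i' \<or> j')"
proof -
  \<comment> \<open>The existence of elements of order 4 and commutativity pass along an
    isomorphism; its inverse supplies the converse implications.\<close>
  have imp: "(f \<longrightarrow> f') \<and> (\<not> (i \<or> j) \<longrightarrow> \<not> (i' \<or> j'))"
    if fj: "j \<longrightarrow> \<not> f" "j' \<longrightarrow> \<not> f'" and iso: "ext_group q f i j \<cong> ext_group q f' i' j'"
    for f i j f' i' j'
  proof -
    let ?G = "ext_group q f i j" and ?H = "ext_group q f' i' j'"
    obtain h where h: "h \<in> iso ?G ?H"
      using iso by (auto simp: is_iso_def)
    interpret G: group ?G
      using q fj by (intro group_ext_group) auto
    interpret H: group ?H
      using q fj by (intro group_ext_group) auto
    interpret h: group_hom ?G ?H h
      using h by unfold_locales (simp add: iso_def)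
    have inj: "inj_on h (ext_carrier q)" and surj: "h ` ext_carrier q = ext_carrier q"
      using h by (simp_all add: iso_def bij_betw_def ext_group_simps)
    have car: "carrier ?G = ext_carrier q" "carrier ?H = ext_carrier q"
      by (simp_all add: ext_group_simps)
    have f' if f
    proof -
      obtain a where a: "a \<in> ext_carrier q" "a \<otimes>\<^bsub>?G\<^esub> a \<noteq> \<one>\<^bsub>?G\<^esub>"
        "(a \<otimes>\<^bsub>?G\<^esub> a) \<otimes>\<^bsub>?G\<^esub> (a \<otimes>\<^bsub>?G\<^esub> a) = \<one>\<^bsub>?G\<^esub>"
        using \<open>f\<close> ext_group_order4_iff[OF q(1) fj(1), of i] by blast
      have aa: "a \<otimes>\<^bsub>?G\<^esub> a \<in> ext_carrier q"
        using a(1) G.m_closed car by simp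
      have hm: "h (b \<otimes>\<^bsub>?G\<^esub> c) = h b \<otimes>\<^bsub>?H\<^esub> h c" if "b \<in> ext_carrier q" "c \<in> ext_carrier q" for b c
        using that h.hom_mult car by simp
      have "h (a \<otimes>\<^bsub>?G\<^esub> a) \<noteq> h \<one>\<^bsub>?G\<^esub>"
        using a inj aa G.one_closed unfolding car by (metis inj_onD)
      then have "h a \<otimes>\<^bsub>?H\<^esub> h a \<noteq> \<one>\<^bsub>?H\<^esub>"
        using a(1) by (simp only: hm h.hom_one not_False_eq_True)
      moreover have "h ((a \<otimes>\<^bsub>?G\<^esub> a) \<otimes>\<^bsub>?G\<^esub> (a \<otimes>\<^bsub>?G\<^esub> a)) = \<one>\<^bsub>?H\<^esub>"
        unfolding a(3) by (rule h.hom_one)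
      then have "(h a \<otimes>\<^bsub>?H\<^esub> h a) \<otimes>\<^bsub>?H\<^esub> (h a \<otimes>\<^bsub>?H\<^esub> h a) = \<one>\<^bsub>?H\<^esub>"
        using a(1) aa by (simp only: hm)
      moreover have "h a \<in> ext_carrier q"
        using a(1) surj by blast
      ultimately show ?thesis
        using ext_group_order4_iff[OF q(1) fj(2), of i'] by blast
    qed
    moreover have "\<not> (i' \<or> j')" if "\<not> (i \<or> j)"
    proof -
      have "h a \<otimes>\<^bsub>?H\<^esub> h b = h b \<otimes>\<^bsub>?H\<^esub> h a" if "a \<in> ext_carrier q" "b \<in> ext_carrier q" for a b
        using that \<open>\<not> (i \<or> j)\<close> ext_group_comm_iff[OF q(2), of f i j] h.hom_mult car by metis
      then have "\<forall>a\<in>h ` ext_carrier q. \<forall>b\<in>h ` ext_carrier q. a \<otimes>\<^bsub>?H\<^esub> b = b \<otimes>\<^bsub>?H\<^esub> a"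
        by blast
      then show ?thesis
        unfolding surj using ext_group_comm_iff[OF q(2), of f' i' j'] by blast
    qed
    ultimately show ?thesis by blast
  qed
  have "ext_group q f' i' j' \<cong> ext_group q f i j"
    using q fj by (intro group.iso_sym[OF group_ext_group iso]) auto
  then show ?thesis
    using imp[OF fj iso] imp[OF fj(2,1)] by blast
qed

text \<open>A brace isomorphism is an additive automorphism, hence of the form in
  \<open>ext_automorphism_form\<close>. Comparing products of (0,1,0) with itself, of (0,u,v) with
  (1,0,0), and of (1,0,0) with (0,1,0) recovers \<open>f\<close>, then \<open>i\<close> and
  \<open>j\<close>, then \<open>d\<close>.\<close>

lemma model_isomorphic_imp_eq:
  assumes q: "prime q" "odd q"
    and j: "j \<longrightarrow> \<not> f \<and> \<not> i" "j' \<longrightarrow> \<not> f' \<and> \<not> i'"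
    and iso: "brace_isomorphic (model q e f i j d) (model q e f' i' j' d')"
  shows "(f, i, j, d) = (f', i', j', d')"
proof -
  let ?M = "model q e f i j d" and ?N = "model q e f' i' j' d'"
  have q2: "q > 2"
    using q prime_ge_2_nat[OF q(1)] by (cases "q = 2") auto
  obtain h where h: "h \<in> iso (ext_group q e True False) (ext_group q e True False)" "h \<in> iso ?M ?N"
    using iso unfolding brace_isomorphic_def brace_iso_def model_simps(4) by blast
  have "h \<in> hom (ext_group q e True False) (ext_group q e True False)" "inj_on h (ext_carrier q)"
    using h(1) by (simp_all add: iso_def bij_betw_def ext_group_simps(1))
  then obtain m t w where m: "0 < m" "m < int q" and t: "0 \<le> t" "t < int q"
    and h_form: "\<And>x u v. 0 \<le> x \<Longrightarrow> x < int q \<Longrightarrow>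
      h (x, u, v) = ((m * x + (if u then t else 0)) mod int q, u, v \<noteq> (w \<and> u))"
    using ext_automorphism_form[OF q] by metis
  have mult: "h ((x, u, v) \<otimes>\<^bsub>?M\<^esub> (x', u', v')) = h (x, u, v) \<otimes>\<^bsub>?N\<^esub> h (x', u', v')"
    if "0 \<le> x" "x < int q" "0 \<le> x'" "x' < int q" for x u v x' u' v'
    using h(2) that by (simp add: iso_def hom_def model_simps(1) ext_carrier_def)
  have sg_eq: "b = c" if "[a + sg b * m = a + sg c * m] (mod int q)" for a b c
  proof -
    have "coprime m (int q)"
      using m q(1) by (metis coprime_commute prime_imp_coprime prime_nat_int_transfer zdvd_not_zless)
    moreover have "[sg b * m = sg c * m] (mod int q)"
      using that by (simp add: cong_add_lcancel)
    ultimately show ?thesis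
      using sg_cong_iff[OF q2] cong_mult_rcancel by blast
  qed
  have f: "f = f'"
    using mult[of 0 0 True False True False] q2 by (auto simp: h_form model_simps)
  have n: "((i \<and> u) \<noteq> (j \<and> v)) = ((i' \<and> u) \<noteq> (j' \<and> (v \<noteq> (w \<and> u))))" for u v
  proof -
    have "h ((0, u, v) \<otimes>\<^bsub>?M\<^esub> (1, False, False)) = h (0, u, v) \<otimes>\<^bsub>?N\<^esub> h (1, False, False)"
      using q2 by (intro mult) auto
    then have "[(if u then t else 0) + sg (u \<noteq> ((i \<and> u) \<noteq> (j \<and> v))) * m =
        (if u then t else 0) + sg (u \<noteq> ((i' \<and> u) \<noteq> (j' \<and> (v \<noteq> (w \<and> u))))) * m] (mod int q)"
      using q2 m t unfolding cong_def model_simps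
      by (simp add: h_form mod_lin mod_simps split: if_splits) (simp_all add: model_simps algebra_simps)
    from sg_eq[OF this] show ?thesis by blast
  qed
  have d: "d = d'"
  proof -
    have "h ((1, False, False) \<otimes>\<^bsub>?M\<^esub> (0, True, False)) = h (1, False, False) \<otimes>\<^bsub>?N\<^esub> h (0, True, False)"
      using q2 by (intro mult) auto
    then have "[t + sg d * m = t + sg d' * m] (mod int q)"
      using q2 m t unfolding cong_def model_simps
      by (simp add: h_form mod_lin mod_simps model_simps algebra_simps)
    then show ?thesis by (rule sg_eq)
  qed
  \<comment> \<open>The bit \<open>w\<close> can only add \<open>j'\<close> to \<open>i'\<close>;
    the normalization that \<open>j\<close> excludes \<open>i\<close> removes this
    ambiguity.\<close>
  show ?thesis
    using f d n[of False True] n[of True False] j by auto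
qed

lemma card_quotient_eq:
  assumes R: "equiv S R" and N: "\<And>p. p \<in> I \<Longrightarrow> N p \<in> S"
    and inj: "\<And>p p'. p \<in> I \<Longrightarrow> p' \<in> I \<Longrightarrow> (N p, N p') \<in> R \<Longrightarrow> p = p'"
    and surj: "\<And>x. x \<in> S \<Longrightarrow> \<exists>p\<in>I. (N p, x) \<in> R"
  shows "card (S // R) = card I"
proof -
  have "bij_betw (\<lambda>p. R `` {N p}) I (S // R)"
  proof (rule bij_betwI')
    show "(R `` {N p} = R `` {N p'}) = (p = p')" if "p \<in> I" "p' \<in> I" for p p'
      using that inj N eq_equiv_class[OF _ R] by metis
    show "R `` {N p} \<in> S // R" if "p \<in> I" for p
      using N[OF that] by (rule quotientI)
    show "\<exists>p\<in>I. X = R `` {N p}" if "X \<in> S // R" for X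
      using that surj by (metis R equiv_class_eq quotientE)
  qed
  then show ?thesis
    by (simp add: bij_betw_same_card)
qed

text \<open>The models are a system of representatives. The bit \<open>k\<close> tells whether the
  multiplicative group is nonabelian, and \<open>(i = d) \<or> j\<close> is its value for a model by
  \<open>model_mult_iso\<close>.\<close>

lemma num_skew_braces_eq_card:
  assumes q: "prime q" "[q = 3] (mod 4)"
    and X: "ext_group q e True False \<cong> X" and Y: "ext_group q f k False \<cong> Y"
  shows "num_skew_braces X Y = card {(i, j, d). (j \<longrightarrow> \<not> f \<and> \<not> i) \<and> ((i = d) \<or> j) = k}"
    (is "_ = card ?I")
proof -
  have q2: "q > 2"
    using prime_ge_2_nat[OF q(1)] q(2) by (cases "q = 2") (auto simp: cong_def)
  then have q0: "q > 0" and odd: "odd q"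
    using q(1) prime_odd_nat by auto
  let ?M = "\<lambda>(i, j, d). model q e f i j d"
  \<comment> \<open>The classes are formed from skew braces on \<open>nat\<close>, so every model
    needs a copy there.\<close>
  have "\<forall>p\<in>?I. \<exists>C :: nat ring. skew_brace C \<and> brace_isomorphic (?M p) C"
    using q0 by (intro ballI skew_brace_copy_on_nat)
      (auto intro: skew_brace_model simp: model_simps ext_carrier_def)
  from bchoice[OF this] obtain N :: "bool \<times> bool \<times> bool \<Rightarrow> nat ring"
    where "\<forall>p\<in>?I. skew_brace (N p) \<and> brace_isomorphic (?M p) (N p)" ..
  then have N: "skew_brace (N p) \<and> brace_isomorphic (?M p) (N p)" if "p \<in> ?I" for p
    using that by (rule bspec)
  have X': "X \<cong> ext_group q e True False" and Y': "Y \<cong> ext_group q f k False"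
    using X Y q0 by (auto intro: group.iso_sym group_ext_group)
  have isoD: "B \<cong> C" "add_monoid B \<cong> add_monoid C" if "brace_isomorphic B C"
    for B :: "'x ring" and C :: "'y ring"
    using that by (auto simp: brace_isomorphic_def brace_iso_def is_iso_def)
  have N_mem: "N p \<in> skew_braces_of_type X Y" if p: "p \<in> ?I" for p
  proof -
    obtain i j d where ijd: "p = (i, j, d)" "j \<longrightarrow> \<not> f" "((i = d) \<or> j) = k"
      using p by auto
    have N': "brace_isomorphic (N p) (model q e f i j d)"
      using N[OF p] skew_brace_model[OF q0 ijd(2)] ijd(1) by (auto intro: brace_isomorphic_sym)
    have "add_monoid (N p) \<cong> X"
      using isoD(2)[OF N'] X unfolding model_simps(4) by (rule iso_trans)
    moreover have "model q e f i j d \<cong> ext_group q f (i = d) j"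
      using model_mult_iso[OF q0, of d f i j e] ijd(2) q0
      by (intro group.iso_sym[OF group_ext_group]) (auto simp: is_iso_def)
    then have "N p \<cong> Y"
      using isoD(1)[OF N'] ext_group_iso_canonical[OF q0 ijd(2), of "i = d"] Y
      unfolding ijd(3) by (blast intro: iso_trans)
    ultimately show ?thesis
      using N[OF p] by (simp add: skew_braces_of_type_def)
  qed
  show ?thesis
    unfolding num_skew_braces_def
  proof (rule card_quotient_eq[OF equiv_iso_rel_of_type N_mem])
    fix p p' assume p: "p \<in> ?I" "p' \<in> ?I" and rel: "(N p, N p') \<in> iso_rel_of_type X Y"
    obtain i j d i' j' d' where ijd: "p = (i, j, d)" "p' = (i', j', d')"
      by (metis prod_cases3)
    have "brace_isomorphic (N p) (N p')"
      using rel by (simp add: iso_rel_of_type_def)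
    moreover have "brace_isomorphic (model q e f i j d) (N p)"
      using N[OF p(1)] ijd by simp
    moreover have "brace_isomorphic (N p') (model q e f i' j' d')"
      using N[OF p(2)] skew_brace_model[OF q0] p(2) ijd by (auto intro: brace_isomorphic_sym)
    ultimately have "brace_isomorphic (model q e f i j d) (model q e f i' j' d')"
      by (blast intro: brace_isomorphic_trans)
    then show "p = p'"
      using model_isomorphic_imp_eq[OF q(1) odd, of j f i j' f i' e d d'] p ijd by auto
  next
    fix B assume B: "B \<in> skew_braces_of_type X Y"
    then have B': "skew_brace B" "add_monoid B \<cong> ext_group q e True False" "B \<cong> ext_group q f k False"
      using X' Y' by (auto simp: skew_braces_of_type_def intro: iso_trans)
    obtain f' i j d where j: "j \<longrightarrow> \<not> f' \<and> \<not> i" and M: "brace_isomorphic B (model q e f' i j d)"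
      using skew_brace_isomorphic_model[OF q B'(1,2)] by blast
    have sM: "skew_brace (model q e f' i j d)"
      using j q0 by (intro skew_brace_model) auto
    have MB: "brace_isomorphic (model q e f' i j d) B"
      using B'(1) M by (rule brace_isomorphic_sym)
    have "ext_group q f' (i = d) j \<cong> model q e f' i j d"
      using model_mult_iso[OF q0, of d f' i j e] by (auto simp: is_iso_def)
    also have "\<dots> \<cong> B"
      by (rule isoD(1)[OF MB])
    also note B'(3)
    finally have "f' = f \<and> ((i = d) \<or> j) = (k \<or> False)"
      using j by (intro ext_group_iso_imp_eq[OF odd q2]) auto
    then have p: "(i, j, d) \<in> ?I" and f': "f' = f"
      using j by auto
    have "brace_isomorphic (N (i, j, d)) (model q e f' i j d)"
      using N[OF p] sM f' by (auto intro: brace_isomorphic_sym)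
    then have "brace_isomorphic (N (i, j, d)) B"
      using MB by (rule brace_isomorphic_trans)
    then have "(N (i, j, d), B) \<in> iso_rel_of_type X Y"
      using N_mem[OF p] B by (simp add: iso_rel_of_type_def)
    then show "\<exists>p\<in>?I. (N p, B) \<in> iso_rel_of_type X Y"
      using p by blast
  qed
qed

lemma card_model_parameters:
  "card {(i, j, d). (j \<longrightarrow> \<not> f \<and> \<not> i) \<and> ((i = d) \<or> j) = k} = (if \<not> f \<and> k then 4 else 2)"
    (is "card ?I = _")
proof -
  \<comment> \<open>If \<open>j\<close> is set, then \<open>i\<close> and \<open>f\<close> are
    clear, \<open>k\<close> holds and \<open>d\<close> is free; if \<open>j\<close> is clear,
    \<open>k\<close> only decides whether \<open>i\<close> and \<open>d\<close> agree.\<close>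
  have "?I = (if k then {(False, False, False), (True, False, True)} \<union>
      (if f then {} else {(False, True, False), (False, True, True)})
    else {(False, False, True), (True, False, False)})"
    by (cases f; cases k) auto
  then show ?thesis
    by simp
qed

theorem mainTheorem6:
  fixes q :: nat
  defines "Z4q \<equiv> integer_mod_group (4 * q)"
    and "Z22q \<equiv> (integer_mod_group 2 \<times>\<times> integer_mod_group 2) \<times>\<times> integer_mod_group q"
    and "Dic \<equiv> inversion_semidirect q 4"
    and "Z2Dih \<equiv> integer_mod_group 2 \<times>\<times> inversion_semidirect q 2"
  assumes "prime q" and "[q = 3] (mod 4)" and "q \<noteq> 3"
  shows "num_skew_braces Dic Z4q = 2 \<and> num_skew_braces Dic Dic = 2 \<and>
         num_skew_braces Dic Z22q = 2 \<and> num_skew_braces Dic Z2Dih = 4 \<and>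
         num_skew_braces Z2Dih Z4q = 2 \<and> num_skew_braces Z2Dih Dic = 2 \<and>
         num_skew_braces Z2Dih Z22q = 2 \<and> num_skew_braces Z2Dih Z2Dih = 4"
proof -
  have "q > 0"
    using assms(5) by (rule prime_gt_0_nat)
  have "q mod 4 = 3"
    using assms(6) by (simp add: cong_def)
  then have "odd q"
    by presburger
  \<comment> \<open>The four types are the pairs of a carry bit and an abelian or nonabelian sign;
    the two nonabelian ones also serve as additive groups.\<close>
  have iso: "ext_group q True False False \<cong> Z4q" "ext_group q True True False \<cong> Dic"
    "ext_group q False False False \<cong> Z22q" "ext_group q False True False \<cong> Z2Dih"
    unfolding assms(1-4)
    using ext_group_iso_Z4q[OF \<open>odd q\<close>] ext_group_iso_Dic[OF \<open>q > 0\<close>]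
      ext_group_iso_Z22q[OF \<open>q > 0\<close>] ext_group_iso_Z2Dih[OF \<open>q > 0\<close>, of True False] by simp_all
  note num = num_skew_braces_eq_card[OF assms(5,6)]
  show ?thesis
    by (simp only: num[OF iso(2) iso(1)] num[OF iso(2) iso(2)] num[OF iso(2) iso(3)] num[OF iso(2) iso(4)]
        num[OF iso(4) iso(1)] num[OF iso(4) iso(2)] num[OF iso(4) iso(3)] num[OF iso(4) iso(4)]
        card_model_parameters) simp
qed

end
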